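(* Let $K$ be a field, $A = K[X_1,\ldots,X_n]$, and let $0\neq I \subsetneq A$ be a universal squarefree lexsegment ideal (USLI). Then $I$ has a unique extremal Betti number, and its value is equal to $1$.
   Context: $A=K[X_1,\dots,X_n]$ is standard graded. For squarefree monomials of the same degree $u=X_{i_1}\cdots X_{i_d}$, $v=X_{j_1}\cdots X_{j_d}$ with $i_1<\cdots<i_d$ and $j_1<\cdots<j_d$, write $u>_{\mathrm{slex}}v$ if for some $1\le s\le d$ one has $i_1=j_1,\ldots,i_{s-1}=j_{s-1}$ and $i_s<j_s$. A monomial ideal $I\subsetneq A$ is a squarefree lexsegment ideal if it is generated by squarefree monomials and for all squarefree monomials $u\in I$ and all squarefree monomials $v\in A$ with $\deg u=\deg v$ and $v>_{\mathrm{slex}}u$ one has $v\in I$. For $m\ge1$ put $A_{[m]}=K[X_1,\ldots,X_n,X_{n+1},\ldots,X_{n+m}]$. A squarefree lexsegment ideal $I$ of $A$ is a universal squarefree lexsegment ideal (USLI) if for every integer $m\ge 1$ the ideal $IA_{[m]}$ is a squarefree lexsegment ideal of $A_{[m]}$. The graded Betti numbers of $I$ are $\beta_{i,j}(I)=\dim_K \mathrm{Tor}_i^A(K,I)_j$. A Betti number $\beta_{k,k+\ell}(I)\neq 0$ is called extremal if $\beta_{i,i+j}(I)=0$ for all $i\ge k$, $j\ge \ell$ with $(i,j)\ne(k,\ell)$. *)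

theory Defs
  imports Complex_Main "HOL-Library.Poly_Mapping" "HOL-Library.Function_Algebras" "HOL-Algebra.Ideal"
begin

text \<open>
  An exponent vector is a finitely supported map from variable indices to exponents; a polynomial
  is a finitely supported map from exponent vectors to coefficients. \<open>pring n\<close> is
  \<open>K[X\<^sub>1,\<dots>,X\<^sub>n]\<close>, so that \<open>pring n\<close> is literally a subring of \<open>pring (n + m)\<close>.
\<close>

type_synonym mon = "nat \<Rightarrow>\<^sub>0 nat"
type_synonym 'k mpoly = "mon \<Rightarrow>\<^sub>0 'k"

definition pring :: "nat \<Rightarrow> 'k::field mpoly ring" where
  "pring n = \<lparr>carrier = {p. \<forall>m\<in>Poly_Mapping.keys p. Poly_Mapping.keys m \<subseteq> {1..n}},
     mult = (*), one = 1, zero = 0, add = (+)\<rparr>"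

definition monomial :: "mon \<Rightarrow> 'k::field mpoly" where
  "monomial m = Poly_Mapping.single m 1"

definition mdeg :: "mon \<Rightarrow> nat" where
  "mdeg m = (\<Sum>i\<in>Poly_Mapping.keys m. Poly_Mapping.lookup m i)"

definition sqfree :: "nat \<Rightarrow> mon \<Rightarrow> bool" where
  "sqfree n m \<longleftrightarrow> Poly_Mapping.keys m \<subseteq> {1..n} \<and> (\<forall>i. Poly_Mapping.lookup m i \<le> 1)"

text \<open>The increasing list of indices \<open>i\<^sub>1 < \<dots> < i\<^sub>d\<close> of the variables occurring in a monomial.\<close>

definition mindices :: "mon \<Rightarrow> nat list" where
  "mindices m = sorted_list_of_set (Poly_Mapping.keys m)"

text \<open>\<open>slex_greater u v\<close> is \<open>u >\<^bsub>slex\<^esub> v\<close>; it is meant for squarefree monomials of equal degree.\<close>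

definition slex_greater :: "mon \<Rightarrow> mon \<Rightarrow> bool" where
  "slex_greater u v \<longleftrightarrow> mdeg u = mdeg v \<and>
     (\<exists>s<mdeg u. (\<forall>t<s. mindices u ! t = mindices v ! t) \<and> mindices u ! s < mindices v ! s)"

definition sqfree_lexsegment_ideal :: "nat \<Rightarrow> 'k::field mpoly set \<Rightarrow> bool" where
  "sqfree_lexsegment_ideal n I \<longleftrightarrow>
     ideal I (pring n) \<and> I \<noteq> carrier (pring n) \<and>
     (\<exists>G. (\<forall>m\<in>G. sqfree n m) \<and> I = genideal (pring n) (monomial ` G)) \<and>
     (\<forall>u v. sqfree n u \<longrightarrow> monomial u \<in> I \<longrightarrow> sqfree n v \<longrightarrow> mdeg u = mdeg v \<longrightarrow>
        slex_greater v u \<longrightarrow> monomial v \<in> I)"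

definition USLI :: "nat \<Rightarrow> 'k::field mpoly set \<Rightarrow> bool" where
  "USLI n I \<longleftrightarrow> sqfree_lexsegment_ideal n I \<and>
     (\<forall>m\<ge>1. sqfree_lexsegment_ideal (n + m) (genideal (pring (n + m)) I))"

text \<open>
  A complex of finitely generated graded free modules with an augmentation to \<open>A\<close>:
  \<open>F\<^sub>i = \<Oplus>\<^bsub>b < rk i\<^esub> A(- shift i b)\<close> has a basis indexed by \<open>b < rk i\<close>, the basis element \<open>b\<close> having
  degree \<open>shift i b\<close>; the differential \<open>F\<^bsub>i+1\<^esub> \<rightarrow> F\<^sub>i\<close> sends the basis element \<open>b\<close> of
  \<open>F\<^bsub>i+1\<^esub>\<close> to the vector with coordinates \<open>diff i b c\<close> (for \<open>c < rk i\<close>), and \<open>F\<^sub>0 \<rightarrow> A\<close> sends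
  the basis element \<open>b\<close> to \<open>aug b\<close>.
\<close>

record (overloaded) 'k gcomplex =
  rk :: "nat \<Rightarrow> nat"
  shift :: "nat \<Rightarrow> nat \<Rightarrow> int"
  diff :: "nat \<Rightarrow> nat \<Rightarrow> nat \<Rightarrow> 'k mpoly"
  aug :: "nat \<Rightarrow> 'k mpoly"

text \<open>The zero polynomial is homogeneous of every degree.\<close>

definition homogeneous :: "'k::field mpoly \<Rightarrow> int \<Rightarrow> bool" where
  "homogeneous p d \<longleftrightarrow> (\<forall>m\<in>Poly_Mapping.keys p. int (mdeg m) = d)"

definition free_mod :: "nat \<Rightarrow> nat \<Rightarrow> (nat \<Rightarrow> 'k::field mpoly) set" where
  "free_mod n r = {v. (\<forall>b<r. v b \<in> carrier (pring n)) \<and> (\<forall>b\<ge>r. v b = 0)}"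

text \<open>The map \<open>R\<^sup>r \<rightarrow> R\<^sup>s\<close> of free modules sending the basis element \<open>b\<close> to \<open>\<Sum>\<^bsub>c < s\<^esub> M b c \<cdot> c\<close>.\<close>

definition mat_map :: "nat \<Rightarrow> nat \<Rightarrow> (nat \<Rightarrow> nat \<Rightarrow> 'r::comm_ring_1) \<Rightarrow> (nat \<Rightarrow> 'r) \<Rightarrow> nat \<Rightarrow> 'r" where
  "mat_map r s M v = (\<lambda>c. if c < s then \<Sum>b<r. v b * M b c else 0)"

definition res_diff :: "'k::field gcomplex \<Rightarrow> nat \<Rightarrow> (nat \<Rightarrow> 'k mpoly) \<Rightarrow> nat \<Rightarrow> 'k mpoly" where
  "res_diff F i = mat_map (rk F (Suc i)) (rk F i) (diff F i)"

definition res_aug :: "'k::field gcomplex \<Rightarrow> (nat \<Rightarrow> 'k mpoly) \<Rightarrow> 'k mpoly" where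
  "res_aug F v = (\<Sum>b<rk F 0. v b * aug F b)"

definition graded_free_resolution :: "nat \<Rightarrow> 'k::field mpoly set \<Rightarrow> 'k gcomplex \<Rightarrow> bool" where
  "graded_free_resolution n I F \<longleftrightarrow>
     (\<forall>b<rk F 0. aug F b \<in> carrier (pring n) \<and> homogeneous (aug F b) (shift F 0 b)) \<and>
     (\<forall>i. \<forall>b<rk F (Suc i). \<forall>c<rk F i. diff F i b c \<in> carrier (pring n) \<and>
        homogeneous (diff F i b c) (shift F (Suc i) b - shift F i c)) \<and>
     res_aug F ` free_mod n (rk F 0) = I \<and>
     {v \<in> free_mod n (rk F 0). res_aug F v = 0} = res_diff F 0 ` free_mod n (rk F 1) \<and>
     (\<forall>i. {v \<in> free_mod n (rk F (Suc i)). res_diff F i v = 0}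
        = res_diff F (Suc i) ` free_mod n (rk F (Suc (Suc i))))"

text \<open>
  The residue field \<open>K = A/(X\<^sub>1,\<dots>,X\<^sub>n)\<close> is an \<open>A\<close>-algebra through \<open>p \<mapsto> p(0)\<close>. Hence
  \<open>K \<otimes>\<^sub>A F\<^sub>i\<close> is the graded vector space over \<open>K\<close> on the basis of \<open>F\<^sub>i\<close>, and \<open>K \<otimes>\<^sub>A d\<close> is
  given by the matrix of constant terms. \<open>tens F i j\<close> is \<open>(K \<otimes>\<^sub>A F\<^sub>i)\<^sub>j\<close>, and
  \<open>tens_diff F i\<close> is the differential \<open>K \<otimes>\<^sub>A F\<^bsub>i+1\<^esub> \<rightarrow> K \<otimes>\<^sub>A F\<^sub>i\<close>.
\<close>

definition tens :: "'k::field gcomplex \<Rightarrow> nat \<Rightarrow> int \<Rightarrow> (nat \<Rightarrow> 'k) set" where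
  "tens F i j = {v. \<forall>b. v b \<noteq> 0 \<longrightarrow> b < rk F i \<and> shift F i b = j}"

definition tens_diff :: "'k::field gcomplex \<Rightarrow> nat \<Rightarrow> (nat \<Rightarrow> 'k) \<Rightarrow> nat \<Rightarrow> 'k" where
  "tens_diff F i =
     mat_map (rk F (Suc i)) (rk F i) (\<lambda>b c. Poly_Mapping.lookup (diff F i b c) 0)"

definition tor_cycles :: "'k::field gcomplex \<Rightarrow> nat \<Rightarrow> int \<Rightarrow> (nat \<Rightarrow> 'k) set" where
  "tor_cycles F i j =
     (case i of 0 \<Rightarrow> tens F 0 j | Suc i' \<Rightarrow> {v \<in> tens F (Suc i') j. tens_diff F i' v = 0})"

definition tor_boundaries :: "'k::field gcomplex \<Rightarrow> nat \<Rightarrow> int \<Rightarrow> (nat \<Rightarrow> 'k) set" where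
  "tor_boundaries F i j = tens_diff F i ` tens F (Suc i) j"

abbreviation kdim :: "(nat \<Rightarrow> 'k::field) set \<Rightarrow> nat" where
  "kdim \<equiv> vector_space.dim (\<lambda>a v b. a * v b)"

text \<open>
  The graded Betti number \<open>dim\<^sub>K Tor\<^sub>i\<^sup>A(K,I)\<^sub>j\<close>: the dimension of the homology
  \<open>H\<^sub>i(K \<otimes>\<^sub>A F)\<^sub>j\<close> (finite-dimensional cycles modulo boundaries) for a graded free resolution \<open>F\<close> of \<open>I\<close>. As usual
  for Tor, the value does not depend on the resolution chosen.
\<close>

definition tor_dim :: "'k::field gcomplex \<Rightarrow> nat \<Rightarrow> int \<Rightarrow> nat" where
  "tor_dim F i j = kdim (tor_cycles F i j) - kdim (tor_boundaries F i j)"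

definition betti :: "nat \<Rightarrow> 'k::field mpoly set \<Rightarrow> nat \<Rightarrow> int \<Rightarrow> nat" where
  "betti n I = tor_dim (SOME F. graded_free_resolution n I F)"

definition extremal_betti :: "nat \<Rightarrow> 'k::field mpoly set \<Rightarrow> nat \<Rightarrow> int \<Rightarrow> bool" where
  "extremal_betti n I k l \<longleftrightarrow> betti n I k (int k + l) \<noteq> 0 \<and>
     (\<forall>i j. k \<le> i \<longrightarrow> l \<le> j \<longrightarrow> (i, j) \<noteq> (k, l) \<longrightarrow> betti n I i (int i + j) = 0)"

end

(* Let I be a nonzero USLI. Since I stays lexsegment after adding variables, the first variable X_1 can
   be peeled off: either X_1 lies in I and I = (X_1) + I', or X_1 divides every generator (a generator
   avoiding X_1 would put X_1 times a product of new variables, hence X_1 itself, into I) and I = X_1 I';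
   in both cases I' is of the same kind in the later variables. On minimal resolutions of the quotient,
   I' -> X_1 I' shifts all degrees by one, and I' -> (X_1) + I' is the mapping cone of multiplication
   by X_1. Both operations preserve the property that the last module of the resolution has rank one
   and carries the largest value of j among all nonzero beta_(i,i+j), which gives the
   unique extremal Betti number. The usual comparison of resolutions (lifting and homotopy) transfers
   the result from this resolution to the arbitrary, possibly non-minimal one in the definition of Tor. *)

theory Submission
  imports Defs
begin

section \<open>Polynomials\<close>

text \<open>Resolving A/I instead of I lets the induction start at the zero ideal, whose quotient A
  has a one-term resolution with corner (k,l) = (0,0). Adjoining a variable moves the corner to
  (k+1,l). Multiplying by one moves it to (k,l+1), but only if k > 0, since the copy of A in
  position 0 cannot be twisted; so multiplication is applied to nonzero ideals only. The ring stays
  K[X_1,...,X_n] throughout; what moves is the index p of the variable to be peeled off. An ideal is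
  encoded by the set L of supports of its monomials, with no bound on the indices, so that one L
  serves I and all its extensions, and universality becomes a single lexsegment condition on finite
  sets of naturals. Betti numbers are defined by an arbitrary resolution, whose differentials may
  survive tensoring. Two consequences of comparing it with a minimal one suffice: a Betti number
  vanishes in a degree where the minimal module has no basis element, and is 1 where that module has
  rank one and its basis element has the given degree.\<close>

abbreviation pcar :: "nat \<Rightarrow> 'k::field mpoly set" where
  "pcar n \<equiv> carrier (pring n)"

lemma pring_simps [simp]:
  "mult (pring n) = (*)" "one (pring n) = 1" "zero (pring n) = 0" "add (pring n) = (+)"
  by (simp_all add: pring_def)

lemma mem_pcar: "p \<in> pcar n \<longleftrightarrow> (\<forall>m\<in>Poly_Mapping.keys p. Poly_Mapping.keys m \<subseteq> {1..n})"
  by (simp add: pring_def)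

lemma keys_add_nat:
  fixes a b :: "'a \<Rightarrow>\<^sub>0 nat"
  shows "Poly_Mapping.keys (a + b) = Poly_Mapping.keys a \<union> Poly_Mapping.keys b"
  by (auto simp: in_keys_iff lookup_add)

lemma keys_diff_subset: "Poly_Mapping.keys (p - q) \<subseteq> Poly_Mapping.keys p \<union> Poly_Mapping.keys q"
  for p :: "'a \<Rightarrow>\<^sub>0 'b::ab_group_add"
  by (auto simp: in_keys_iff lookup_minus)

lemma pcar_zero [simp, intro]: "0 \<in> pcar n"
  by (simp add: mem_pcar)

lemma pcar_one [simp, intro]: "1 \<in> pcar n"
  by (simp add: mem_pcar)

lemma pcar_add [intro]: "p \<in> pcar n \<Longrightarrow> q \<in> pcar n \<Longrightarrow> p + q \<in> pcar n"
  using keys_add[of p q] unfolding mem_pcar by blast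

lemma pcar_diff [intro]: "p \<in> pcar n \<Longrightarrow> q \<in> pcar n \<Longrightarrow> p - q \<in> pcar n"
  using keys_diff_subset[of p q] unfolding mem_pcar by blast

lemma pcar_uminus [simp]: "- p \<in> pcar n \<longleftrightarrow> p \<in> pcar n"
  by (simp add: mem_pcar)

lemma pcar_mult [intro]:
  assumes "p \<in> pcar n" "q \<in> pcar n"
  shows "p * q \<in> pcar n"
  unfolding mem_pcar
proof
  fix m assume "m \<in> Poly_Mapping.keys (p * q)"
  then obtain a b where "m = a + b" "a \<in> Poly_Mapping.keys p" "b \<in> Poly_Mapping.keys q"
    using keys_mult[of p q] by blast
  then show "Poly_Mapping.keys m \<subseteq> {1..n}"
    using assms unfolding mem_pcar by (auto simp: keys_add_nat)
qed

lemma pcar_sum [intro]: "(\<And>b. b \<in> B \<Longrightarrow> f b \<in> pcar n) \<Longrightarrow> (\<Sum>b\<in>B. f b) \<in> pcar n"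
  by (induction B rule: infinite_finite_induct) auto

lemma pcar_single [simp]:
  "Poly_Mapping.single m c \<in> pcar n \<longleftrightarrow> c = 0 \<or> Poly_Mapping.keys m \<subseteq> {1..n}"
  by (auto simp: mem_pcar)

lemma ring_pring: "ring (pring n :: 'k::field mpoly ring)"
proof -
  have inv: "\<exists>y\<in>pcar n. x + y = 0" if "x \<in> pcar n" for x :: "'k mpoly"
    using that by (intro bexI[of _ "- x"]) auto
  have "comm_group (add_monoid (pring n :: 'k mpoly ring))"
    by unfold_locales (auto simp: algebra_simps Units_def inv pcar_add)
  then have ag: "abelian_group (pring n :: 'k mpoly ring)"
    by (simp add: abelian_group_def abelian_group_axioms_def comm_group.axioms(1) abelian_monoid_def)
  show ?thesis
    by (rule ringI[OF ag]) (unfold_locales, auto simp: algebra_simps)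
qed

section \<open>Degrees, homogeneous polynomials and constant terms\<close>

lemma mdeg_add: "mdeg (a + b) = mdeg a + mdeg b"
proof -
  have *: "mdeg c = (\<Sum>i\<in>Poly_Mapping.keys a \<union> Poly_Mapping.keys b. Poly_Mapping.lookup c i)"
    if "Poly_Mapping.keys c \<subseteq> Poly_Mapping.keys a \<union> Poly_Mapping.keys b" for c
    unfolding mdeg_def using that by (intro sum.mono_neutral_left) (auto simp: in_keys_iff)
  show ?thesis
    by (subst (1 2 3) *) (auto simp: keys_add_nat lookup_add sum.distrib)
qed

lemma mdeg_eq_0_iff [simp]: "mdeg m = 0 \<longleftrightarrow> m = 0"
proof
  assume "mdeg m = 0"
  then have "Poly_Mapping.lookup m i = 0" for i
    by (cases "i \<in> Poly_Mapping.keys m") (auto simp: mdeg_def in_keys_iff)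
  then show "m = 0" by (intro poly_mapping_eqI) simp
qed (simp add: mdeg_def)

lemma homogeneous_zero [simp]: "homogeneous 0 d"
  by (simp add: homogeneous_def)

lemma homogeneous_add [intro]: "homogeneous p d \<Longrightarrow> homogeneous q d \<Longrightarrow> homogeneous (p + q) d"
  using keys_add[of p q] unfolding homogeneous_def by blast

lemma homogeneous_uminus [simp]: "homogeneous (- p) d \<longleftrightarrow> homogeneous p d"
  by (simp add: homogeneous_def)

lemma homogeneous_diff [intro]: "homogeneous p d \<Longrightarrow> homogeneous q d \<Longrightarrow> homogeneous (p - q) d"
  using keys_diff_subset[of p q] unfolding homogeneous_def by blast

lemma homogeneous_mult:
  assumes "homogeneous p d" "homogeneous q e" "d + e = f"
  shows "homogeneous (p * q) f"
  unfolding homogeneous_def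
proof
  fix m assume "m \<in> Poly_Mapping.keys (p * q)"
  then obtain a b where "m = a + b" "a \<in> Poly_Mapping.keys p" "b \<in> Poly_Mapping.keys q"
    using keys_mult[of p q] by blast
  then show "int (mdeg m) = f"
    using assms unfolding homogeneous_def by (auto simp: mdeg_add)
qed

lemma homogeneous_sum [intro]:
  "(\<And>b. b \<in> B \<Longrightarrow> homogeneous (f b) d) \<Longrightarrow> homogeneous (\<Sum>b\<in>B. f b) d"
  by (induction B rule: infinite_finite_induct) auto

lemma homogeneous_one [simp]: "homogeneous 1 0"
  by (simp add: homogeneous_def)

abbreviation const_coeff :: "'k::field mpoly \<Rightarrow> 'k" where
  "const_coeff p \<equiv> Poly_Mapping.lookup p 0"

text \<open>Degrees of monomials add in the naturals, so 1 factors only as 1 * 1. Evaluation at 0 is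
  thus multiplicative, and tensoring with \<open>K\<close> becomes taking constant terms of
  matrices.\<close>

lemma const_coeff_mult: "const_coeff (p * q) = const_coeff p * const_coeff q"
proof -
  have split: "0 = l + q \<longleftrightarrow> l = 0 \<and> q = 0" for l q :: mon
    by (metis add.right_neutral mdeg_add mdeg_eq_0_iff add_eq_0_iff_both_eq_0)
  have "(\<Sum>q'. Poly_Mapping.lookup q q' when 0 = l + q') = (const_coeff q when l = 0)" for l
  proof (cases "l = 0")
    case True
    then show ?thesis
      using Sum_any_when_equal'[of "Poly_Mapping.lookup q" 0] by simp
  next
    case False
    then show ?thesis by (simp add: split)
  qed
  then show ?thesis
    by (simp add: lookup_mult mult_when)
qed

lemma homogeneous_const_coeff: "homogeneous p d \<Longrightarrow> const_coeff p \<noteq> 0 \<Longrightarrow> d = 0"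
  unfolding homogeneous_def by (metis in_keys_iff mdeg_eq_0_iff of_nat_0)

text \<open>One device for two decompositions: by degree, giving homogeneous components, and by
  divisibility by a variable, giving \<open>f = g + X_p h\<close>.\<close>

definition pm_filter :: "('a \<Rightarrow> bool) \<Rightarrow> ('a \<Rightarrow>\<^sub>0 'b) \<Rightarrow> ('a \<Rightarrow>\<^sub>0 'b::zero)" where
  "pm_filter P p = Abs_poly_mapping (\<lambda>m. Poly_Mapping.lookup p m when P m)"

lemma lookup_pm_filter [simp]:
  "Poly_Mapping.lookup (pm_filter P p) m = (Poly_Mapping.lookup p m when P m)"
proof -
  have "finite {m. (Poly_Mapping.lookup p m when P m) \<noteq> 0}"
    by (rule finite_subset[OF _ finite_keys[of p]]) (auto simp: in_keys_iff)
  then show ?thesis by (simp add: pm_filter_def)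
qed

lemma keys_pm_filter [simp]: "Poly_Mapping.keys (pm_filter P p) = {m \<in> Poly_Mapping.keys p. P m}"
  by (auto simp: in_keys_iff)

lemma pm_filter_add: "pm_filter P (p + q) = pm_filter P p + pm_filter P (q :: 'a \<Rightarrow>\<^sub>0 'b::monoid_add)"
  by (intro poly_mapping_eqI) (simp add: lookup_add when_add_distrib)

lemma pm_filter_zero [simp]: "pm_filter P 0 = 0"
  by (intro poly_mapping_eqI) simp

lemma pm_filter_sum:
  "pm_filter P (\<Sum>b\<in>B. f b) = (\<Sum>b\<in>B. pm_filter P (f b :: 'a \<Rightarrow>\<^sub>0 'b::comm_monoid_add))"
  by (induction B rule: infinite_finite_induct) (auto simp: pm_filter_add)

lemma pm_filter_split: "p = pm_filter P p + pm_filter (\<lambda>m. \<not> P m) p"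
  for p :: "'a \<Rightarrow>\<^sub>0 'b::monoid_add"
  by (intro poly_mapping_eqI) (auto simp: lookup_add when_def)

lemma pm_filter_id: "(\<And>m. m \<in> Poly_Mapping.keys p \<Longrightarrow> P m) \<Longrightarrow> pm_filter P p = p"
  by (intro poly_mapping_eqI) (auto simp: when_def in_keys_iff)

lemma pm_filter_eq_zero: "(\<And>m. m \<in> Poly_Mapping.keys p \<Longrightarrow> \<not> P m) \<Longrightarrow> pm_filter P p = 0"
  by (intro poly_mapping_eqI) (auto simp: when_def in_keys_iff)

lemma pcar_pm_filter [intro]: "p \<in> pcar n \<Longrightarrow> pm_filter P p \<in> pcar n"
  by (simp add: mem_pcar)

definition hcomp :: "int \<Rightarrow> 'k::field mpoly \<Rightarrow> 'k mpoly" where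
  "hcomp d = pm_filter (\<lambda>m. int (mdeg m) = d)"

lemma homogeneous_hcomp [simp, intro]: "homogeneous (hcomp d p) d"
  by (simp add: hcomp_def homogeneous_def)

lemma hcomp_id: "homogeneous p d \<Longrightarrow> hcomp d p = p"
  unfolding hcomp_def homogeneous_def by (rule pm_filter_id) auto

text \<open>As \<open>q\<close> has degree \<open>e\<close>, the terms of \<open>p\<close> of degree
  other than \<open>d - e\<close> contribute only outside degree \<open>d\<close>.\<close>

lemma hcomp_mult:
  assumes "homogeneous q e"
  shows "hcomp d (p * q) = hcomp (d - e) p * q"
proof -
  let ?r = "pm_filter (\<lambda>m. \<not> int (mdeg m) = d - e) p"
  have "p * q = hcomp (d - e) p * q + ?r * q"
    unfolding hcomp_def by (subst pm_filter_split[of p "\<lambda>m. int (mdeg m) = d - e"]) (simp add: algebra_simps)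
  moreover have "hcomp d (hcomp (d - e) p * q) = hcomp (d - e) p * q"
    by (intro hcomp_id homogeneous_mult[OF _ assms]) auto
  moreover have "hcomp d (?r * q) = 0"
    unfolding hcomp_def
  proof (rule pm_filter_eq_zero)
    fix m assume "m \<in> Poly_Mapping.keys (?r * q)"
    then obtain a b where "m = a + b" "a \<in> Poly_Mapping.keys ?r" "b \<in> Poly_Mapping.keys q"
      using keys_mult[of ?r q] by blast
    then show "int (mdeg m) \<noteq> d"
      using assms unfolding homogeneous_def by (auto simp: mdeg_add)
  qed
  ultimately show ?thesis
    by (simp add: hcomp_def pm_filter_add)
qed

lemma hcomp_sum: "hcomp d (\<Sum>b\<in>B. f b) = (\<Sum>b\<in>B. hcomp d (f b))"
  by (simp add: hcomp_def pm_filter_sum)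

lemma pm_eq_sum_single: "p = (\<Sum>m\<in>Poly_Mapping.keys p. Poly_Mapping.single m (Poly_Mapping.lookup p m))"
  for p :: "'a \<Rightarrow>\<^sub>0 'b::comm_monoid_add"
  by (intro poly_mapping_eqI) (auto simp: lookup_sum lookup_single when_def in_keys_iff)

section \<open>Graded free modules and resolutions\<close>

lemma free_mod_D: "v \<in> free_mod n r \<Longrightarrow> b < r \<Longrightarrow> v b \<in> pcar n"
  by (simp add: free_mod_def)

lemma free_mod_zero: "v \<in> free_mod n r \<Longrightarrow> r \<le> b \<Longrightarrow> v b = 0"
  by (simp add: free_mod_def)

lemma free_mod_0 [simp, intro]: "0 \<in> free_mod n r"
  by (simp add: free_mod_def)

lemma free_mod_add: "v \<in> free_mod n r \<Longrightarrow> w \<in> free_mod n r \<Longrightarrow> v + w \<in> free_mod n r"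
  by (auto simp: free_mod_def)

lemma free_mod_diff: "v \<in> free_mod n r \<Longrightarrow> w \<in> free_mod n r \<Longrightarrow> v - w \<in> free_mod n r"
  by (auto simp: free_mod_def)

lemma mat_map_add: "mat_map r s M (v + w) = mat_map r s M v + mat_map r s M w"
  by (auto simp: mat_map_def fun_eq_iff algebra_simps sum.distrib)

lemma mat_map_uminus: "mat_map r s M (- v) = - mat_map r s M v"
  by (auto simp: mat_map_def fun_eq_iff sum_negf)

lemma mat_map_diff: "mat_map r s M (v - w) = mat_map r s M v - mat_map r s M w"
  by (auto simp: mat_map_def fun_eq_iff algebra_simps sum_subtractf)

lemma mat_map_zero [simp]: "mat_map r s M 0 = 0"
  by (auto simp: mat_map_def fun_eq_iff)

lemma mat_map_scale: "mat_map r s M (\<lambda>b. a * v b) = (\<lambda>c. a * mat_map r s M v c)"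
  by (auto simp: mat_map_def fun_eq_iff sum_distrib_left mult.assoc)

lemma mat_map_cong:
  "(\<And>b. b < r \<Longrightarrow> v b = v' b) \<Longrightarrow> (\<And>b c. b < r \<Longrightarrow> c < s \<Longrightarrow> M b c = M' b c) \<Longrightarrow>
    mat_map r s M v = mat_map r s M' v'"
  by (auto simp: mat_map_def fun_eq_iff intro!: sum.cong)

lemma mat_map_zero_matrix: "(\<And>b c. b < r \<Longrightarrow> c < s \<Longrightarrow> M b c = 0) \<Longrightarrow> mat_map r s M v = 0"
  by (auto simp: mat_map_def fun_eq_iff)

text \<open>Row \<open>b\<close> of a matrix is the image of the basis element \<open>b\<close>, so
  the rows of a composite are the images of the rows of the first factor. The identity is applied
  both over the polynomial ring and over \<open>K\<close>.\<close>

lemma mat_map_comp: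
  "mat_map q t N (mat_map r q M v) = mat_map r t (\<lambda>b. mat_map q t N (M b)) v"
proof
  fix c
  show "mat_map q t N (mat_map r q M v) c = mat_map r t (\<lambda>b. mat_map q t N (M b)) v c"
  proof (cases "c < t")
    case True
    have "(\<Sum>e<q. (\<Sum>b<r. v b * M b e) * N e c) = (\<Sum>e<q. \<Sum>b<r. v b * (M b e * N e c))"
      by (simp add: sum_distrib_right mult.assoc)
    also have "\<dots> = (\<Sum>b<r. \<Sum>e<q. v b * (M b e * N e c))"
      by (rule sum.swap)
    finally show ?thesis using True
      by (simp add: mat_map_def sum_distrib_left)
  qed (simp add: mat_map_def)
qed

lemma mat_map_add_matrix:
  "mat_map r s (\<lambda>b. M b + N b) v = mat_map r s M v + mat_map r s N v"
  by (auto simp: mat_map_def fun_eq_iff algebra_simps sum.distrib)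

text \<open>Serves also as the standard basis: \<open>id_mat b\<close> is the basis vector
  \<open>b\<close>, for every rank above \<open>b\<close>.\<close>

definition id_mat :: "nat \<Rightarrow> nat \<Rightarrow> 'r::comm_ring_1" where
  "id_mat b c = (if c = b then 1 else 0)"

lemma mat_map_id: "(\<And>b. r \<le> b \<Longrightarrow> v b = 0) \<Longrightarrow> mat_map r r id_mat v = v"
  by (auto simp: mat_map_def fun_eq_iff id_mat_def if_distrib cong: if_cong)

lemma mat_map_id_mat_row:
  assumes "b < r"
  shows "mat_map r s M (id_mat b) = (\<lambda>c. if c < s then M b c else 0)"
proof
  fix c
  have "(\<Sum>e<r. id_mat b e * M e c) = (\<Sum>e<r. if e = b then M e c else 0)"
    by (rule sum.cong) (auto simp: id_mat_def)
  then show "mat_map r s M (id_mat b) c = (if c < s then M b c else 0)"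
    using assms by (simp add: mat_map_def)
qed

lemma id_mat_free_mod: "b < r \<Longrightarrow> id_mat b \<in> free_mod n r"
  by (auto simp: free_mod_def id_mat_def)

lemma mat_map_free_mod:
  assumes "v \<in> free_mod n r" "\<And>b c. b < r \<Longrightarrow> c < s \<Longrightarrow> M b c \<in> pcar n"
  shows "mat_map r s M v \<in> free_mod n s"
  using assms by (auto simp: free_mod_def mat_map_def intro!: pcar_sum pcar_mult)

text \<open>The degree \<open>e\<close> part of the graded free module that is the direct sum of the
  \<open>A(- s c)\<close> for \<open>c < r\<close>.\<close>

definition hvec :: "nat \<Rightarrow> nat \<Rightarrow> (nat \<Rightarrow> int) \<Rightarrow> int \<Rightarrow> (nat \<Rightarrow> 'k::field mpoly) \<Rightarrow> bool" where
  "hvec n r s e v \<longleftrightarrow> v \<in> free_mod n r \<and> (\<forall>c<r. homogeneous (v c) (e - s c))"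

text \<open>The matrices of degree-preserving maps; \<open>s\<close> and \<open>t\<close> list the
  degrees of the two bases.\<close>

definition hmat :: "nat \<Rightarrow> nat \<Rightarrow> (nat \<Rightarrow> int) \<Rightarrow> nat \<Rightarrow> (nat \<Rightarrow> int) \<Rightarrow>
    (nat \<Rightarrow> nat \<Rightarrow> 'k::field mpoly) \<Rightarrow> bool" where
  "hmat n r s q t M \<longleftrightarrow> (\<forall>b<r. hvec n q t (s b) (M b))"

lemma hvec_0 [simp, intro]: "hvec n r s e 0"
  by (simp add: hvec_def)

lemma hvec_diff: "hvec n r s e v \<Longrightarrow> hvec n r s e w \<Longrightarrow> hvec n r s e (v - w)"
  by (auto simp: hvec_def free_mod_diff)

lemma hmat_D:
  assumes "hmat n r s q t M" "b < r"
  shows "M b \<in> free_mod n q" "\<And>c. c < q \<Longrightarrow> M b c \<in> pcar n"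
    "\<And>c. c < q \<Longrightarrow> homogeneous (M b c) (s b - t c)"
  using assms by (auto simp: hmat_def hvec_def free_mod_def)

lemma hmat_id: "hmat n r s r s id_mat"
  by (auto simp: hmat_def hvec_def id_mat_free_mod) (simp add: id_mat_def)

lemma hvec_mat_map:
  assumes "hvec n r s e v" "hmat n r s q t M"
  shows "hvec n q t e (mat_map r q M v)"
proof -
  have "mat_map r q M v \<in> free_mod n q"
    using assms(1) hmat_D(2)[OF assms(2)] by (intro mat_map_free_mod) (auto simp: hvec_def)
  moreover have "homogeneous (mat_map r q M v c) (e - t c)" if "c < q" for c
    using that assms unfolding mat_map_def
    by (auto intro!: homogeneous_sum homogeneous_mult[OF _ hmat_D(3)[OF assms(2)]] simp: hvec_def)
  ultimately show ?thesis by (simp add: hvec_def)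
qed

lemma hmat_comp:
  assumes "hmat n r s q t M" "hmat n q t p u N"
  shows "hmat n r s p u (\<lambda>b. mat_map q p N (M b))"
  using assms by (auto simp: hmat_def intro!: hvec_mat_map[of n q t])

text \<open>Taking homogeneous components of an arbitrary preimage gives a homogeneous one.\<close>

lemma homogeneous_preimage:
  assumes M: "hmat n r s q t M" and v: "hvec n q t e v"
    and w: "w \<in> free_mod n r" "mat_map r q M w = v"
  shows "\<exists>w'. hvec n r s e w' \<and> mat_map r q M w' = v"
proof (intro exI conjI)
  let ?w = "\<lambda>b. if b < r then hcomp (e - s b) (w b) else 0"
  show "hvec n r s e ?w"
    using w(1) by (auto simp: hvec_def free_mod_def hcomp_def) (auto simp: hcomp_def[symmetric])
  show "mat_map r q M ?w = v"
  proof
    fix c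
    show "mat_map r q M ?w c = v c"
    proof (cases "c < q")
      case True
      have "v c = hcomp (e - t c) (v c)"
        using v True by (simp add: hvec_def hcomp_id)
      also have "\<dots> = hcomp (e - t c) (\<Sum>b<r. w b * M b c)"
        using True w(2) by (auto simp: mat_map_def)
      also have "\<dots> = (\<Sum>b<r. hcomp (e - s b) (w b) * M b c)"
        unfolding hcomp_sum
        by (intro sum.cong refl) (simp add: hcomp_mult[OF hmat_D(3)[OF M _ True]])
      finally show ?thesis using True by (simp add: mat_map_def)
    next
      case False
      then show ?thesis using v free_mod_zero[of v n q c] by (auto simp: mat_map_def hvec_def)
    qed
  qed
qed

text \<open>
  A resolution \<open>\<dots> \<rightarrow> F\<^sub>1 \<rightarrow> F\<^sub>0 \<rightarrow> I \<rightarrow> 0\<close> is treated as the resolution \<open>\<dots> \<rightarrow> F\<^sub>1 \<rightarrow> F\<^sub>0 \<rightarrow> A\<close> of \<open>A/I\<close>,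
  with \<open>A\<close> in position \<open>0\<close> and \<open>F\<^sub>i\<close> in position \<open>i + 1\<close>; the field \<open>aug\<close> is unused.
\<close>

definition quot_resolution :: "nat \<Rightarrow> 'k::field mpoly set \<Rightarrow> 'k gcomplex \<Rightarrow> bool" where
  "quot_resolution n J X \<longleftrightarrow> rk X 0 = 1 \<and> shift X 0 0 = 0 \<and>
     (\<forall>i. \<forall>b<rk X (Suc i). \<forall>c<rk X i. diff X i b c \<in> pcar n \<and>
        homogeneous (diff X i b c) (shift X (Suc i) b - shift X i c)) \<and>
     {v \<in> free_mod n 1. v 0 \<in> J} = res_diff X 0 ` free_mod n (rk X 1) \<and>
     (\<forall>i. {v \<in> free_mod n (rk X (Suc i)). res_diff X i v = 0}
        = res_diff X (Suc i) ` free_mod n (rk X (Suc (Suc i))))"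

definition extend :: "'k::field gcomplex \<Rightarrow> 'k gcomplex" where
  "extend F = \<lparr>rk = case_nat 1 (rk F), shift = case_nat (\<lambda>_. 0) (shift F),
     diff = case_nat (\<lambda>b c. aug F b) (diff F), aug = \<lambda>_. 0\<rparr>"

definition truncate :: "'k::field gcomplex \<Rightarrow> 'k gcomplex" where
  "truncate X = \<lparr>rk = \<lambda>i. rk X (Suc i), shift = \<lambda>i. shift X (Suc i),
     diff = \<lambda>i. diff X (Suc i), aug = \<lambda>b. diff X 0 b 0\<rparr>"

lemma extend_simps [simp]:
  "rk (extend F) 0 = 1" "rk (extend F) (Suc i) = rk F i"
  "shift (extend F) 0 = (\<lambda>_. 0)" "shift (extend F) (Suc i) = shift F i"
  "diff (extend F) 0 = (\<lambda>b c. aug F b)" "diff (extend F) (Suc i) = diff F i"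
  by (simp_all add: extend_def)

lemma truncate_simps [simp]:
  "rk (truncate X) i = rk X (Suc i)" "shift (truncate X) i = shift X (Suc i)"
  "diff (truncate X) i = diff X (Suc i)" "aug (truncate X) b = diff X 0 b 0"
  by (simp_all add: truncate_def)

lemma res_diff_extend:
  "res_diff (extend F) 0 v = (\<lambda>c. if c = 0 then res_aug F v else 0)"
  "res_diff (extend F) (Suc i) v = res_diff F i v"
  by (auto simp: res_diff_def res_aug_def mat_map_def fun_eq_iff)

lemma res_diff_truncate: "res_diff (truncate X) i = res_diff X (Suc i)"
  by (simp add: res_diff_def fun_eq_iff)

lemma res_aug_truncate: "rk X 0 = 1 \<Longrightarrow> res_aug (truncate X) v = res_diff X 0 v 0"
  by (simp add: res_diff_def res_aug_def mat_map_def)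

lemma free_mod_1_eq: "{v \<in> free_mod n 1. v 0 \<in> J} = (\<lambda>p c. if c = 0 then p else 0) ` (J \<inter> pcar n)"
proof (intro equalityI subsetI)
  fix v assume v: "v \<in> {v \<in> free_mod n 1. v 0 \<in> J}"
  then have "v = (\<lambda>c. if c = 0 then v 0 else 0)"
    by (auto simp: free_mod_def fun_eq_iff)
  then show "v \<in> (\<lambda>p c. if c = 0 then p else 0) ` (J \<inter> pcar n)"
    using v by (intro image_eqI[of _ _ "v 0"]) (auto simp: free_mod_def)
qed (auto simp: free_mod_def)

text \<open>Only the seam differs from \<open>F\<close>: surjectivity onto \<open>J\<close> becomes
  exactness at \<open>A\<close>, and for \<open>i = 0\<close> the remaining conditions are those on
  \<open>aug\<close>.\<close>

lemma quot_resolution_extend: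
  assumes "graded_free_resolution n J F" "J \<subseteq> pcar n"
  shows "quot_resolution n J (extend F)"
  unfolding quot_resolution_def
proof (intro conjI)
  let ?X = "extend F"
  note g = assms(1)[unfolded graded_free_resolution_def]
  show "\<forall>i. \<forall>b<rk ?X (Suc i). \<forall>c<rk ?X i. diff ?X i b c \<in> pcar n \<and>
        homogeneous (diff ?X i b c) (shift ?X (Suc i) b - shift ?X i c)"
  proof
    fix i show "\<forall>b<rk ?X (Suc i). \<forall>c<rk ?X i. diff ?X i b c \<in> pcar n \<and>
        homogeneous (diff ?X i b c) (shift ?X (Suc i) b - shift ?X i c)"
      using g by (cases i) auto
  qed
  have "res_diff ?X 0 ` free_mod n (rk ?X 1)
      = (\<lambda>p c. if c = 0 then p else 0) ` res_aug F ` free_mod n (rk F 0)"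
    by (simp add: image_image res_diff_extend)
  also have "\<dots> = {v \<in> free_mod n 1. v 0 \<in> J}"
    using g assms(2) by (simp only: free_mod_1_eq) (simp add: Int_absorb2)
  finally show "{v \<in> free_mod n 1. v 0 \<in> J} = res_diff ?X 0 ` free_mod n (rk ?X 1)" ..
  have zero: "res_diff ?X 0 v = 0 \<longleftrightarrow> res_aug F v = 0" for v
    by (auto simp: res_diff_extend fun_eq_iff)
  show "\<forall>i. {v \<in> free_mod n (rk ?X (Suc i)). res_diff ?X i v = 0}
        = res_diff ?X (Suc i) ` free_mod n (rk ?X (Suc (Suc i)))"
  proof
    fix i show "{v \<in> free_mod n (rk ?X (Suc i)). res_diff ?X i v = 0}
        = res_diff ?X (Suc i) ` free_mod n (rk ?X (Suc (Suc i)))"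
      using g by (cases i) (auto simp: zero res_diff_extend(2))
  qed
qed simp_all

lemma graded_free_resolution_truncate:
  assumes "quot_resolution n J X" "J \<subseteq> pcar n"
  shows "graded_free_resolution n J (truncate X)"
  unfolding graded_free_resolution_def
proof (intro conjI)
  note g = assms(1)[unfolded quot_resolution_def]
  have r0: "rk X 0 = 1" using g by simp
  show "\<forall>b<rk (truncate X) 0. aug (truncate X) b \<in> pcar n \<and>
      homogeneous (aug (truncate X) b) (shift (truncate X) 0 b)"
  proof (intro allI impI)
    fix b assume "b < rk (truncate X) 0"
    then have "diff X 0 b 0 \<in> pcar n \<and> homogeneous (diff X 0 b 0) (shift X (Suc 0) b - shift X 0 0)"
      using g[THEN conjunct2, THEN conjunct2, THEN conjunct1] r0 by simp
    then show "aug (truncate X) b \<in> pcar n \<and> homogeneous (aug (truncate X) b) (shift (truncate X) 0 b)"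
      using g by simp
  qed
  have "res_aug (truncate X) ` free_mod n (rk (truncate X) 0)
      = (\<lambda>v. v 0) ` res_diff X 0 ` free_mod n (rk X 1)"
    by (simp add: image_image res_aug_truncate r0)
  also have "\<dots> = (\<lambda>v. v 0) ` {v \<in> free_mod n 1. v 0 \<in> J}"
    using g by simp
  also have "\<dots> = J"
    using assms(2) by (simp only: free_mod_1_eq) (auto simp: image_image)
  finally show "res_aug (truncate X) ` free_mod n (rk (truncate X) 0) = J" .
  have "res_diff X 0 v = 0 \<longleftrightarrow> res_diff X 0 v 0 = 0" for v
    by (auto simp: res_diff_def fun_eq_iff mat_map_def r0)
  then have "{v \<in> free_mod n (rk (truncate X) 0). res_aug (truncate X) v = 0}
      = {v \<in> free_mod n (rk X (Suc 0)). res_diff X 0 v = 0}"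
    by (simp add: res_aug_truncate r0)
  also have "\<dots> = res_diff X (Suc 0) ` free_mod n (rk X (Suc (Suc 0)))"
    using g by blast
  finally show "{v \<in> free_mod n (rk (truncate X) 0). res_aug (truncate X) v = 0} =
      res_diff (truncate X) 0 ` free_mod n (rk (truncate X) 1)"
    by (simp add: res_diff_truncate)
qed (use assms(1)[unfolded quot_resolution_def] in \<open>auto simp: res_diff_truncate\<close>)

text \<open>\<open>diff\<close> may take arbitrary values outside the ranks. Cutting its rows off
  makes them elements of the free module, to which \<open>hmat\<close> and exactness apply.\<close>

definition diff_row :: "'k::field gcomplex \<Rightarrow> nat \<Rightarrow> nat \<Rightarrow> nat \<Rightarrow> 'k mpoly" where
  "diff_row X i b = (\<lambda>c. if c < rk X i then diff X i b c else 0)"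

lemma res_diff_eq_diff_row: "res_diff X i = mat_map (rk X (Suc i)) (rk X i) (diff_row X i)"
  by (auto simp: res_diff_def diff_row_def fun_eq_iff intro!: mat_map_cong[THEN fun_cong])

lemma hmat_diff_row:
  assumes "quot_resolution n J X"
  shows "hmat n (rk X (Suc i)) (shift X (Suc i)) (rk X i) (shift X i) (diff_row X i)"
  using assms by (auto simp: hmat_def hvec_def quot_resolution_def diff_row_def free_mod_def)

lemma res_diff_free_mod:
  assumes "quot_resolution n J X" "v \<in> free_mod n (rk X (Suc i))"
  shows "res_diff X i v \<in> free_mod n (rk X i)"
  unfolding res_diff_eq_diff_row
  using assms hmat_D(2)[OF hmat_diff_row[OF assms(1)]] by (intro mat_map_free_mod) auto

lemma quot_resolution_exact:
  assumes "quot_resolution n J X" "v \<in> free_mod n (rk X (Suc i))" "res_diff X i v = 0"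
  shows "v \<in> res_diff X (Suc i) ` free_mod n (rk X (Suc (Suc i)))"
  using assms unfolding quot_resolution_def by blast

lemma res_diff_diff_row:
  assumes "quot_resolution n J X" "b < rk X (Suc (Suc i))"
  shows "res_diff X i (diff_row X (Suc i) b) = 0"
proof -
  have "res_diff X (Suc i) (id_mat b) \<in> res_diff X (Suc i) ` free_mod n (rk X (Suc (Suc i)))"
    using assms(2) by (intro imageI id_mat_free_mod)
  moreover have "{v \<in> free_mod n (rk X (Suc i)). res_diff X i v = 0}
      = res_diff X (Suc i) ` free_mod n (rk X (Suc (Suc i)))"
    using assms(1) unfolding quot_resolution_def by blast
  ultimately have "res_diff X i (res_diff X (Suc i) (id_mat b)) = 0"
    by blast
  then show ?thesis
    using assms(2) by (simp add: res_diff_def[of X "Suc i"] mat_map_id_mat_row diff_row_def)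
qed

lemma res_diff_res_diff:
  assumes "quot_resolution n J X"
  shows "res_diff X i (res_diff X (Suc i) v) = 0"
  unfolding res_diff_eq_diff_row[of X "Suc i"] res_diff_def[of X i]
  unfolding mat_map_comp
  using res_diff_diff_row[OF assms] by (intro mat_map_zero_matrix) (simp add: res_diff_def)

section \<open>Comparison of resolutions\<close>

lemma homogeneous_lift:
  assumes X: "quot_resolution n J X" and v: "hvec n (rk X i) (shift X i) e v"
    and im: "v \<in> res_diff X i ` free_mod n (rk X (Suc i))"
  shows "\<exists>w. hvec n (rk X (Suc i)) (shift X (Suc i)) e w \<and> res_diff X i w = v"
proof -
  from im obtain w where "w \<in> free_mod n (rk X (Suc i))" "res_diff X i w = v"
    by auto
  then show ?thesis
    using homogeneous_preimage[OF hmat_diff_row[OF X] v] by (simp add: res_diff_eq_diff_row)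
qed

lemma mat_map_square:
  assumes "\<And>b. b < r \<Longrightarrow> mat_map q t N (M b) = mat_map q' t N' (M' b)"
  shows "mat_map q t N (mat_map r q M v) = mat_map q' t N' (mat_map r q' M' v)"
  unfolding mat_map_comp using assms by (intro mat_map_cong) auto

text \<open>Both complexes begin with \<open>A\<close>, and the maps of interest lift the identity
  of the common quotient; hence position 0 is pinned to the identity.\<close>

definition chain_map :: "nat \<Rightarrow> 'k::field gcomplex \<Rightarrow> 'k gcomplex \<Rightarrow>
    (nat \<Rightarrow> nat \<Rightarrow> nat \<Rightarrow> 'k mpoly) \<Rightarrow> bool" where
  "chain_map n X Y \<Phi> \<longleftrightarrow>
     (\<forall>i. hmat n (rk X i) (shift X i) (rk Y i) (shift Y i) (\<Phi> i)) \<and> \<Phi> 0 = id_mat \<and>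
     (\<forall>i v. res_diff Y i (mat_map (rk X (Suc i)) (rk Y (Suc i)) (\<Phi> (Suc i)) v)
        = mat_map (rk X i) (rk Y i) (\<Phi> i) (res_diff X i v))"

text \<open>Freeness of \<open>X\<close> reduces the choice of each matrix to basis elements,
  exactness of \<open>Y\<close> supplies preimages, and \<open>homogeneous_lift\<close> keeps them
  in the right degree.\<close>

lemma chain_map_exists:
  assumes X: "quot_resolution n J X" and Y: "quot_resolution n J Y"
  shows "\<exists>\<Phi>. chain_map n X Y \<Phi>"
proof -
  \<comment> \<open>The last clause makes the next choice possible. It holds at 0 because both
    complexes have image \<open>J\<close> in \<open>A\<close>, and later because the vector in
    question is a cycle of \<open>Y\<close>.\<close>
  define good where "good i M \<longleftrightarrow> hmat n (rk X i) (shift X i) (rk Y i) (shift Y i) M \<and>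
      (i = 0 \<longrightarrow> M = id_mat) \<and>
      (\<forall>b<rk X (Suc i). mat_map (rk X i) (rk Y i) M (diff_row X i b)
        \<in> res_diff Y i ` free_mod n (rk Y (Suc i)))" for i M
  define step where "step i M M' \<longleftrightarrow> (\<forall>b<rk X (Suc i).
      res_diff Y i (M' b) = mat_map (rk X i) (rk Y i) M (diff_row X i b))" for i M M'
  have comm: "res_diff Y i (mat_map (rk X (Suc i)) (rk Y (Suc i)) M' v)
      = mat_map (rk X i) (rk Y i) M (res_diff X i v)" if "step i M M'" for i M M' v
    unfolding res_diff_eq_diff_row
    using that unfolding step_def by (intro mat_map_square) (simp add: res_diff_eq_diff_row)
  have base: "good 0 id_mat"
    unfolding good_def
  proof (intro conjI allI impI)
    have r: "rk X 0 = 1" "rk Y 0 = 1" "shift X 0 0 = 0" "shift Y 0 0 = 0"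
      using X Y by (auto simp: quot_resolution_def)
    show "hmat n (rk X 0) (shift X 0) (rk Y 0) (shift Y 0) id_mat"
      using hmat_id[of n 1 "shift X 0"] r by (simp add: hmat_def hvec_def)
    fix b assume b: "b < rk X (Suc 0)"
    have row: "diff_row X 0 b \<in> free_mod n 1"
      using hmat_D(1)[OF hmat_diff_row[OF X] b] r by simp
    have "mat_map (rk X 0) (rk Y 0) id_mat (diff_row X 0 b) = diff_row X 0 b"
      unfolding r using free_mod_zero[OF row] by (intro mat_map_id)
    also have "\<dots> = res_diff X 0 (id_mat b)"
      using b by (simp add: res_diff_def mat_map_id_mat_row diff_row_def)
    also have "\<dots> \<in> res_diff X 0 ` free_mod n (rk X 1)"
      using b by (intro imageI id_mat_free_mod) simp
    also have "\<dots> = res_diff Y 0 ` free_mod n (rk Y (Suc 0))"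
      using X Y unfolding quot_resolution_def by (metis One_nat_def)
    finally show "mat_map (rk X 0) (rk Y 0) id_mat (diff_row X 0 b)
        \<in> res_diff Y 0 ` free_mod n (rk Y (Suc 0))" .
  qed simp
  have step: "\<exists>M'. good (Suc i) M' \<and> step i M M'" if M: "good i M" for i M
  proof -
    have "\<exists>w. hvec n (rk Y (Suc i)) (shift Y (Suc i)) (shift X (Suc i) b) w \<and>
        res_diff Y i w = mat_map (rk X i) (rk Y i) M (diff_row X i b)"
      if "b < rk X (Suc i)" for b
    proof (rule homogeneous_lift[OF Y])
      have "hvec n (rk X i) (shift X i) (shift X (Suc i) b) (diff_row X i b)"
        using hmat_diff_row[OF X] that by (auto simp: hmat_def)
      then show "hvec n (rk Y i) (shift Y i) (shift X (Suc i) b)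
          (mat_map (rk X i) (rk Y i) M (diff_row X i b))"
        using M by (auto simp: good_def intro: hvec_mat_map)
    qed (use M that in \<open>auto simp: good_def\<close>)
    then obtain M' where M': "\<And>b. b < rk X (Suc i) \<Longrightarrow>
        hvec n (rk Y (Suc i)) (shift Y (Suc i)) (shift X (Suc i) b) (M' b) \<and>
        res_diff Y i (M' b) = mat_map (rk X i) (rk Y i) M (diff_row X i b)"
      by metis
    have st: "step i M M'" and h: "hmat n (rk X (Suc i)) (shift X (Suc i)) (rk Y (Suc i)) (shift Y (Suc i)) M'"
      using M' by (auto simp: step_def hmat_def)
    have "mat_map (rk X (Suc i)) (rk Y (Suc i)) M' (diff_row X (Suc i) b)
        \<in> res_diff Y (Suc i) ` free_mod n (rk Y (Suc (Suc i)))" if "b < rk X (Suc (Suc i))" for b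
    proof (rule quot_resolution_exact[OF Y])
      show "mat_map (rk X (Suc i)) (rk Y (Suc i)) M' (diff_row X (Suc i) b) \<in> free_mod n (rk Y (Suc i))"
        using hmat_D(1)[OF hmat_diff_row[OF X] that] hmat_D(2)[OF h] by (intro mat_map_free_mod)
      show "res_diff Y i (mat_map (rk X (Suc i)) (rk Y (Suc i)) M' (diff_row X (Suc i) b)) = 0"
        unfolding comm[OF st] res_diff_diff_row[OF X that] by simp
    qed
    then show ?thesis using st h by (auto simp: good_def)
  qed
  obtain \<Phi> where \<Phi>: "\<And>i. good i (\<Phi> i) \<and> step i (\<Phi> i) (\<Phi> (Suc i))"
    using dependent_nat_choice[of good step] base step by metis
  then have "chain_map n X Y \<Phi>"
    unfolding chain_map_def using comm \<Phi> by (auto simp: good_def)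
  then show ?thesis by blast
qed

text \<open>\<open>chain_map\<close> asks for \<open>id_mat\<close> literally in position 0, whereas
  the product of two truncated identities agrees with it on row 0 only; hence the case distinction
  in the family.\<close>

lemma chain_map_comp:
  fixes X Y Z :: "'k::field gcomplex"
  assumes \<Phi>: "chain_map n X Y \<Phi>" and \<Psi>: "chain_map n Y Z \<Psi>" and r: "rk X 0 = 1" "rk Y 0 = 1" "rk Z 0 = 1"
  shows "chain_map n X Z (\<lambda>i. if i = 0 then id_mat else (\<lambda>b. mat_map (rk Y i) (rk Z i) (\<Psi> i) (\<Phi> i b)))"
    (is "chain_map n X Z ?T")
proof -
  have id0: "mat_map 1 1 id_mat (mat_map 1 1 id_mat v) = mat_map 1 1 id_mat v" for v :: "nat \<Rightarrow> 'k mpoly"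
    by (rule mat_map_id) (simp add: mat_map_def)
  have T: "mat_map (rk X i) (rk Z i) (?T i) v
      = mat_map (rk Y i) (rk Z i) (\<Psi> i) (mat_map (rk X i) (rk Y i) (\<Phi> i) v)" for i v
    using \<Phi> \<Psi> r id0 by (cases i) (auto simp: mat_map_comp chain_map_def)
  have h: "hmat n (rk X i) (shift X i) (rk Z i) (shift Z i)
      (\<lambda>b. mat_map (rk Y i) (rk Z i) (\<Psi> i) (\<Phi> i b))" for i
    using \<Phi> \<Psi> by (intro hmat_comp) (auto simp: chain_map_def)
  have "hmat n (rk X 0) (shift X 0) (rk Z 0) (shift Z 0) (id_mat :: nat \<Rightarrow> nat \<Rightarrow> 'k mpoly)"
  proof -
    have "\<Psi> 0 = id_mat" "\<Phi> 0 = id_mat" using \<Phi> \<Psi> by (auto simp: chain_map_def)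
    moreover have "mat_map 1 1 id_mat (id_mat 0) = (id_mat 0 :: nat \<Rightarrow> 'k mpoly)"
      by (rule mat_map_id) (simp add: id_mat_def)
    ultimately show ?thesis using h[of 0] r by (simp add: hmat_def)
  qed
  then have "hmat n (rk X i) (shift X i) (rk Z i) (shift Z i) (?T i)" for i
    using h by simp
  moreover have "res_diff Z i (mat_map (rk X (Suc i)) (rk Z (Suc i)) (?T (Suc i)) v)
        = mat_map (rk X i) (rk Z i) (?T i) (res_diff X i v)" for i v
    unfolding T using \<Phi> \<Psi> by (simp add: chain_map_def)
  ultimately show ?thesis by (simp add: chain_map_def)
qed

text \<open>\<open>\<Theta>\<close> and the identity agree in position 0, so the homotopy can start
  with 0; afterwards the remaining difference is lifted along the exact complex \<open>X\<close>.
  The identity concerns vectors vanishing beyond the rank because only these are reproduced by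
  \<open>id_mat\<close>.\<close>

lemma homotopy_exists:
  assumes X: "quot_resolution n J X" and \<Theta>: "chain_map n X X \<Theta>"
  shows "\<exists>\<Sigma>. (\<forall>i. hmat n (rk X i) (shift X i) (rk X (Suc i)) (shift X (Suc i)) (\<Sigma> i)) \<and> \<Sigma> 0 = 0 \<and>
    (\<forall>i v. (\<forall>b\<ge>rk X (Suc i). v b = 0) \<longrightarrow>
      v - mat_map (rk X (Suc i)) (rk X (Suc i)) (\<Theta> (Suc i)) v =
        res_diff X (Suc i) (mat_map (rk X (Suc i)) (rk X (Suc (Suc i))) (\<Sigma> (Suc i)) v)
        + mat_map (rk X i) (rk X (Suc i)) (\<Sigma> i) (res_diff X i v))"
proof -
  note hD = hmat_diff_row[OF X]
  have h\<Theta>: "hmat n (rk X i) (shift X i) (rk X i) (shift X i) (\<Theta> i)" for i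
    using \<Theta> by (simp add: chain_map_def)
  \<comment> \<open>What the homotopy chosen so far leaves of the identity minus
    \<open>\<Theta>\<close>: a cycle, which the next matrix lifts one position up.\<close>
  define rhs where "rhs i M b = id_mat b - \<Theta> (Suc i) b -
      mat_map (rk X i) (rk X (Suc i)) M (diff_row X i b)" for i M b
  define good where "good i M \<longleftrightarrow> hmat n (rk X i) (shift X i) (rk X (Suc i)) (shift X (Suc i)) M \<and>
      (i = 0 \<longrightarrow> M = 0) \<and> (\<forall>b<rk X (Suc i). res_diff X i (rhs i M b) = 0)" for i M
  define step where "step i M M' \<longleftrightarrow>
      (\<forall>b<rk X (Suc i). res_diff X (Suc i) (M' b) = rhs i M b)" for i M M'
  have row: "id_mat b - \<Theta> (Suc i) b \<in> free_mod n (rk X (Suc i))" if "b < rk X (Suc i)" for i b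
    using that by (intro free_mod_diff id_mat_free_mod hmat_D(1)[OF h\<Theta>])
  have comm: "v - mat_map (rk X (Suc i)) (rk X (Suc i)) (\<Theta> (Suc i)) v =
        res_diff X (Suc i) (mat_map (rk X (Suc i)) (rk X (Suc (Suc i))) M' v)
        + mat_map (rk X i) (rk X (Suc i)) M (res_diff X i v)"
    if st: "step i M M'" and v: "\<forall>b\<ge>rk X (Suc i). v b = 0" for i M M' v
  proof -
    let ?r = "rk X (Suc i)"
    have "mat_map ?r ?r id_mat v = v" using v by (intro mat_map_id) auto
    then have "v = mat_map ?r ?r (\<lambda>b. \<Theta> (Suc i) b + (rhs i M b +
        mat_map (rk X i) ?r M (diff_row X i b))) v"
      by (simp add: rhs_def)
    also have "\<dots> = mat_map ?r ?r (\<Theta> (Suc i)) v + (mat_map ?r ?r (rhs i M) v +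
        mat_map ?r ?r (\<lambda>b. mat_map (rk X i) ?r M (diff_row X i b)) v)"
      by (simp only: mat_map_add_matrix)
    also have "mat_map ?r ?r (\<lambda>b. mat_map (rk X i) ?r M (diff_row X i b)) v =
        mat_map (rk X i) ?r M (res_diff X i v)"
      by (simp add: res_diff_eq_diff_row mat_map_comp)
    also have "mat_map ?r ?r (rhs i M) v = mat_map ?r ?r (\<lambda>b. res_diff X (Suc i) (M' b)) v"
      using st by (intro mat_map_cong) (auto simp: step_def)
    also have "\<dots> = res_diff X (Suc i) (mat_map ?r (rk X (Suc (Suc i))) M' v)"
      by (simp add: res_diff_def mat_map_comp)
    finally show ?thesis by (metis add_diff_cancel_left')
  qed
  have base: "good 0 0"
    unfolding good_def
  proof (intro conjI allI impI)
    show "hmat n (rk X 0) (shift X 0) (rk X (Suc 0)) (shift X (Suc 0)) 0"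
      by (simp add: hmat_def)
    fix b assume b: "b < rk X (Suc 0)"
    have r: "rk X 0 = 1" using X by (simp add: quot_resolution_def)
    have "res_diff X 0 (\<Theta> (Suc 0) b) = res_diff X 0 (mat_map (rk X (Suc 0)) (rk X (Suc 0)) (\<Theta> (Suc 0)) (id_mat b))"
      using b by (simp add: mat_map_id_mat_row) (auto simp: res_diff_def intro!: mat_map_cong)
    also have "\<dots> = mat_map 1 1 id_mat (res_diff X 0 (id_mat b))"
      using \<Theta> r by (simp add: chain_map_def)
    also have "\<dots> = res_diff X 0 (id_mat b)"
      by (rule mat_map_id) (simp add: res_diff_def mat_map_def r)
    finally show "res_diff X 0 (rhs 0 0 b) = 0"
      by (simp add: rhs_def res_diff_def mat_map_diff mat_map_zero_matrix)
  qed simp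
  have step: "\<exists>M'. good (Suc i) M' \<and> step i M M'" if M: "good i M" for i M
  proof -
    have hM: "hmat n (rk X i) (shift X i) (rk X (Suc i)) (shift X (Suc i)) M"
      using M by (simp add: good_def)
    have "\<exists>w. hvec n (rk X (Suc (Suc i))) (shift X (Suc (Suc i))) (shift X (Suc i) b) w \<and>
        res_diff X (Suc i) w = rhs i M b" if b: "b < rk X (Suc i)" for b
    proof (rule homogeneous_lift[OF X])
      show h: "hvec n (rk X (Suc i)) (shift X (Suc i)) (shift X (Suc i) b) (rhs i M b)"
        unfolding rhs_def using b hmat_id h\<Theta>[of "Suc i"] hD
        by (intro hvec_diff hvec_mat_map[OF _ hM]) (auto simp: hmat_def)
      show "rhs i M b \<in> res_diff X (Suc i) ` free_mod n (rk X (Suc (Suc i)))"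
        using M b h by (intro quot_resolution_exact[OF X]) (auto simp: good_def hvec_def)
    qed
    then obtain M' where M': "\<And>b. b < rk X (Suc i) \<Longrightarrow>
        hvec n (rk X (Suc (Suc i))) (shift X (Suc (Suc i))) (shift X (Suc i) b) (M' b) \<and>
        res_diff X (Suc i) (M' b) = rhs i M b"
      by metis
    have st: "step i M M'"
      and h: "hmat n (rk X (Suc i)) (shift X (Suc i)) (rk X (Suc (Suc i))) (shift X (Suc (Suc i))) M'"
      using M' by (auto simp: step_def hmat_def)
    have "res_diff X (Suc i) (rhs (Suc i) M' b) = 0" if b: "b < rk X (Suc (Suc i))" for b
    proof -
      let ?r = "rk X (Suc i)" and ?v = "diff_row X (Suc i) b"
      have v: "?v \<in> free_mod n ?r" using hmat_D(1)[OF hD b] .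
      have "res_diff X (Suc i) (\<Theta> (Suc (Suc i)) b) =
          res_diff X (Suc i) (mat_map (rk X (Suc (Suc i))) (rk X (Suc (Suc i))) (\<Theta> (Suc (Suc i))) (id_mat b))"
        using b by (simp add: mat_map_id_mat_row) (auto simp: res_diff_def intro!: mat_map_cong)
      also have "\<dots> = mat_map ?r ?r (\<Theta> (Suc i)) (res_diff X (Suc i) (id_mat b))"
        using \<Theta> by (simp add: chain_map_def)
      also have eq: "res_diff X (Suc i) (id_mat b) = ?v"
        using b by (simp add: res_diff_def mat_map_id_mat_row diff_row_def)
      finally have 1: "res_diff X (Suc i) (\<Theta> (Suc (Suc i)) b) = mat_map ?r ?r (\<Theta> (Suc i)) ?v" .
      \<comment> \<open>The homotopy identity on a row of the differential, where the term with two
        consecutive differentials drops out; it says that the next remainder is again a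
        cycle.\<close>
      have "?v - mat_map ?r ?r (\<Theta> (Suc i)) ?v =
          res_diff X (Suc i) (mat_map ?r (rk X (Suc (Suc i))) M' ?v)"
        using comm[OF st, of ?v] free_mod_zero[OF v] res_diff_diff_row[OF X b] by simp
      then show ?thesis
        using 1 eq by (simp add: rhs_def res_diff_def mat_map_diff)
    qed
    then show ?thesis using st h by (auto simp: good_def)
  qed
  obtain \<Sigma> where \<Sigma>: "\<And>i. good i (\<Sigma> i) \<and> step i (\<Sigma> i) (\<Sigma> (Suc i))"
    using dependent_nat_choice[of good step] base step by metis
  show ?thesis
    by (intro exI[of _ \<Sigma>] conjI allI impI comm) (use \<Sigma> in \<open>auto simp: good_def\<close>)
qed

section \<open>Reduction to \<open>K\<close>: constant terms of maps, cycles and boundaries\<close>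

abbreviation cc_mat :: "(nat \<Rightarrow> nat \<Rightarrow> 'k::field mpoly) \<Rightarrow> nat \<Rightarrow> nat \<Rightarrow> 'k" where
  "cc_mat M \<equiv> \<lambda>b c. const_coeff (M b c)"

lemma const_coeff_mat_map:
  "(\<lambda>c. const_coeff (mat_map r s M v c)) = mat_map r s (cc_mat M) (\<lambda>b. const_coeff (v b))"
  by (auto simp: mat_map_def fun_eq_iff lookup_sum const_coeff_mult)

text \<open>Lifts a vector over \<open>K\<close> to constant polynomials, so that an identity over
  the polynomial ring can be evaluated on it and then reduced to constant terms.\<close>

definition const_vec :: "(nat \<Rightarrow> 'k::field) \<Rightarrow> nat \<Rightarrow> 'k mpoly" where
  "const_vec w = (\<lambda>b. Poly_Mapping.single 0 (w b))"

lemma const_coeff_const_vec [simp]: "(\<lambda>b. const_coeff (const_vec w b)) = w"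
  by (simp add: const_vec_def)

lemma const_coeff_res_diff:
  "(\<lambda>c. const_coeff (res_diff X i v c)) = tens_diff X i (\<lambda>b. const_coeff (v b))"
  by (simp add: res_diff_def tens_diff_def const_coeff_mat_map)

lemma tens_diff_tens_diff:
  assumes "quot_resolution n J X"
  shows "tens_diff X i (tens_diff X (Suc i) w) = 0"
  using const_coeff_res_diff[of X i "res_diff X (Suc i) (const_vec w)"]
  by (simp add: res_diff_res_diff[OF assms] const_coeff_res_diff fun_eq_iff)

lemma tens_diff_chain_map:
  assumes "chain_map n X Y \<Phi>"
  shows "tens_diff Y i (mat_map (rk X (Suc i)) (rk Y (Suc i)) (cc_mat (\<Phi> (Suc i))) w)
    = mat_map (rk X i) (rk Y i) (cc_mat (\<Phi> i)) (tens_diff X i w)"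
proof -
  have "(\<lambda>c. const_coeff (res_diff Y i (mat_map (rk X (Suc i)) (rk Y (Suc i)) (\<Phi> (Suc i)) (const_vec w)) c))
      = (\<lambda>c. const_coeff (mat_map (rk X i) (rk Y i) (\<Phi> i) (res_diff X i (const_vec w)) c))"
    using assms by (simp add: chain_map_def)
  then show ?thesis
    by (simp add: const_coeff_res_diff const_coeff_mat_map)
qed

text \<open>A homogeneous entry has a nonzero constant term only in degree 0, that is, only between
  basis elements of equal degree.\<close>

lemma tens_mat_map:
  assumes M: "hmat n (rk X i) (shift X i) (rk Y i') (shift Y i') M" and w: "w \<in> tens X i j"
  shows "mat_map (rk X i) (rk Y i') (cc_mat M) w \<in> tens Y i' j"
  unfolding tens_def
proof (intro CollectI allI impI)
  fix c assume c: "mat_map (rk X i) (rk Y i') (cc_mat M) w c \<noteq> 0"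
  then have cr: "c < rk Y i'" by (simp add: mat_map_def split: if_splits)
  then have "(\<Sum>b<rk X i. w b * const_coeff (M b c)) \<noteq> 0"
    using c by (simp add: mat_map_def)
  then obtain b where b: "b < rk X i" "w b * const_coeff (M b c) \<noteq> 0"
    by (meson lessThan_iff sum.neutral)
  then have "shift X i b - shift Y i' c = 0"
    by (intro homogeneous_const_coeff[OF hmat_D(3)[OF M _ cr]]) auto
  moreover have "shift X i b = j" using b w by (auto simp: tens_def)
  ultimately show "c < rk Y i' \<and> shift Y i' c = j" using cr by simp
qed

lemma tens_diff_tens:
  assumes "quot_resolution n J X" "w \<in> tens X (Suc i) j"
  shows "tens_diff X i w \<in> tens X i j"
proof -
  have "tens_diff X i w = mat_map (rk X (Suc i)) (rk X i) (cc_mat (diff_row X i)) w"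
    unfolding tens_diff_def by (intro mat_map_cong) (auto simp: diff_row_def)
  then show ?thesis
    using tens_mat_map[OF hmat_diff_row[OF assms(1)] assms(2)] by simp
qed

definition minimal_complex :: "'k::field gcomplex \<Rightarrow> bool" where
  "minimal_complex X \<longleftrightarrow> (\<forall>i. \<forall>b<rk X (Suc i). \<forall>c<rk X i. const_coeff (diff X i b c) = 0)"

lemma minimal_tens_diff: "minimal_complex X \<Longrightarrow> tens_diff X i w = 0"
  unfolding tens_diff_def minimal_complex_def by (intro mat_map_zero_matrix) auto

text \<open>Position \<open>Suc i\<close> of the extension is position \<open>i\<close> of
  \<open>F\<close>. For \<open>i = 0\<close> the next map goes to \<open>A\<close>, which belongs to
  the resolution of the quotient but not to that of the ideal, so no cycle condition
  remains.\<close>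

lemma tor_cycles_extend:
  "z \<in> tor_cycles F i j \<longleftrightarrow>
    z \<in> tens (extend F) (Suc i) j \<and> (i \<noteq> 0 \<longrightarrow> tens_diff (extend F) i z = 0)"
  by (cases i) (auto simp: tor_cycles_def tens_def tens_diff_def)

lemma tor_boundaries_extend:
  "tor_boundaries F i j = tens_diff (extend F) (Suc i) ` tens (extend F) (Suc (Suc i)) j"
  by (simp add: tor_boundaries_def tens_def tens_diff_def)

lemma boundaries_subset_cycles:
  assumes E: "quot_resolution n J (extend F)"
  shows "tor_boundaries F i j \<subseteq> tor_cycles F i j"
proof
  fix z assume "z \<in> tor_boundaries F i j"
  then obtain y where y: "y \<in> tens (extend F) (Suc (Suc i)) j" "z = tens_diff (extend F) (Suc i) y"
    by (auto simp: tor_boundaries_extend)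
  then show "z \<in> tor_cycles F i j"
    using tens_diff_tens[OF E y(1)] tens_diff_tens_diff[OF E, of i y] by (simp add: tor_cycles_extend)
qed

text \<open>Constant terms of the homotopy identity give a boundary plus \<open>\<Sigma> i\<close>
  applied to the differential of \<open>z\<close>. The second term vanishes if \<open>z\<close> is a
  cycle, and for \<open>i = 0\<close> because \<open>\<Sigma> 0 = 0\<close>, which matches the
  absent cycle condition there.\<close>

lemma homotopic_modulo_boundaries:
  assumes X: "quot_resolution n J X" and \<Theta>: "chain_map n X X \<Theta>"
    and z: "z \<in> tens X (Suc i) j" "i \<noteq> 0 \<Longrightarrow> tens_diff X i z = 0"
  shows "z - mat_map (rk X (Suc i)) (rk X (Suc i)) (cc_mat (\<Theta> (Suc i))) z
    \<in> tens_diff X (Suc i) ` tens X (Suc (Suc i)) j"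
proof -
  let ?r = "rk X (Suc i)"
  obtain \<Sigma> where h: "\<And>i. hmat n (rk X i) (shift X i) (rk X (Suc i)) (shift X (Suc i)) (\<Sigma> i)"
    and \<Sigma>0: "\<Sigma> 0 = 0"
    and eq: "\<And>v. (\<forall>b\<ge>?r. v b = 0) \<Longrightarrow>
      v - mat_map ?r ?r (\<Theta> (Suc i)) v =
        res_diff X (Suc i) (mat_map ?r (rk X (Suc (Suc i))) (\<Sigma> (Suc i)) v)
        + mat_map (rk X i) ?r (\<Sigma> i) (res_diff X i v)"
    using homotopy_exists[OF X \<Theta>] by blast
  have "\<forall>b\<ge>?r. z b = 0"
  proof (intro allI impI)
    fix b assume "?r \<le> b" then show "z b = 0" using z(1) unfolding tens_def by (metis (mono_tags, lifting) mem_Collect_eq not_less)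
  qed
  then have "\<forall>b\<ge>?r. const_vec z b = 0" by (simp add: const_vec_def)
  note eq' = eq[OF this]
  let ?v = "const_vec z"
  have "(\<lambda>c. const_coeff ((?v - mat_map ?r ?r (\<Theta> (Suc i)) ?v) c)) =
      z - mat_map ?r ?r (cc_mat (\<Theta> (Suc i))) z"
    using fun_cong[OF const_coeff_mat_map[of ?r ?r "\<Theta> (Suc i)" ?v]]
    by (simp add: fun_eq_iff lookup_minus const_vec_def)
  moreover have "(\<lambda>c. const_coeff ((res_diff X (Suc i) (mat_map ?r (rk X (Suc (Suc i))) (\<Sigma> (Suc i)) ?v)
        + mat_map (rk X i) ?r (\<Sigma> i) (res_diff X i ?v)) c)) =
      tens_diff X (Suc i) (mat_map ?r (rk X (Suc (Suc i))) (cc_mat (\<Sigma> (Suc i))) z)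
        + mat_map (rk X i) ?r (cc_mat (\<Sigma> i)) (tens_diff X i z)"
  proof -
    have 1: "(\<lambda>c. const_coeff (res_diff X (Suc i) (mat_map ?r (rk X (Suc (Suc i))) (\<Sigma> (Suc i)) ?v) c)) =
        tens_diff X (Suc i) (mat_map ?r (rk X (Suc (Suc i))) (cc_mat (\<Sigma> (Suc i))) z)"
      by (simp add: const_coeff_res_diff const_coeff_mat_map)
    have 2: "(\<lambda>c. const_coeff (mat_map (rk X i) ?r (\<Sigma> i) (res_diff X i ?v) c)) =
        mat_map (rk X i) ?r (cc_mat (\<Sigma> i)) (tens_diff X i z)"
      by (simp add: const_coeff_res_diff const_coeff_mat_map)
    show ?thesis using fun_cong[OF 1] fun_cong[OF 2] by (simp add: fun_eq_iff lookup_add)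
  qed
  moreover have "mat_map (rk X i) ?r (cc_mat (\<Sigma> i)) (tens_diff X i z) = 0"
  proof (cases "i = 0")
    case True
    then show ?thesis using \<Sigma>0 by (intro mat_map_zero_matrix) simp
  qed (use z(2) in simp)
  ultimately have "z - mat_map ?r ?r (cc_mat (\<Theta> (Suc i))) z =
      tens_diff X (Suc i) (mat_map ?r (rk X (Suc (Suc i))) (cc_mat (\<Sigma> (Suc i))) z)"
    using eq' by simp
  then show ?thesis using tens_mat_map[OF h z(1)] by blast
qed

section \<open>Graded Betti numbers from a minimal resolution\<close>

text \<open>Expresses an isomorphism of homology without quotient spaces: \<open>P\<close> and
  \<open>Q\<close> are mutually inverse up to boundaries. On the minimal side the differentials over
  \<open>K\<close> vanish, so homology is \<open>tens X (Suc i) j\<close> itself and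
  \<open>Q\<close> followed by \<open>P\<close> is exactly the identity.\<close>

lemma tor_comparison:
  assumes F: "quot_resolution n J (extend F)" and X: "quot_resolution n J X" and m: "minimal_complex X"
  shows "\<exists>p q P Q.
    (\<forall>z\<in>tor_cycles F i j. mat_map p q P z \<in> tens X (Suc i) j \<and>
      z - mat_map q p Q (mat_map p q P z) \<in> tor_boundaries F i j) \<and>
    (\<forall>z\<in>tor_boundaries F i j. mat_map p q P z = 0) \<and>
    (\<forall>w\<in>tens X (Suc i) j. mat_map q p Q w \<in> tor_cycles F i j \<and>
      mat_map p q P (mat_map q p Q w) = w)"
proof -
  let ?E = "extend F"
  obtain \<Phi> \<Psi> where \<Phi>: "chain_map n ?E X \<Phi>" and \<Psi>: "chain_map n X ?E \<Psi>"
    using chain_map_exists[OF F X] chain_map_exists[OF X F] by blast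
  have r: "rk ?E 0 = 1" "rk X 0 = 1"
    using F X by (auto simp: quot_resolution_def)
  let ?p = "rk ?E (Suc i)" and ?q = "rk X (Suc i)"
  let ?P = "cc_mat (\<Phi> (Suc i))" and ?Q = "cc_mat (\<Psi> (Suc i))"
  have h\<Phi>: "hmat n ?p (shift ?E (Suc i)) ?q (shift X (Suc i)) (\<Phi> (Suc i))"
    and h\<Psi>: "hmat n ?q (shift X (Suc i)) ?p (shift ?E (Suc i)) (\<Psi> (Suc i))"
    using \<Phi> \<Psi> unfolding chain_map_def by blast+
  have comp: "mat_map a c (cc_mat (\<lambda>b. mat_map b' c N (M b))) v =
      mat_map b' c (cc_mat N) (mat_map a b' (cc_mat M) v)"
    for a b' c N v and M :: "nat \<Rightarrow> nat \<Rightarrow> 'a mpoly"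
    unfolding mat_map_comp by (intro mat_map_cong) (simp_all add: const_coeff_mat_map[THEN fun_cong])
  show ?thesis
  proof (rule exI[of _ ?p], rule exI[of _ ?q], rule exI[of _ ?P], rule exI[of _ ?Q], intro conjI ballI)
    fix z assume z: "z \<in> tor_cycles F i j"
    then have z': "z \<in> tens ?E (Suc i) j" "i \<noteq> 0 \<Longrightarrow> tens_diff ?E i z = 0"
      by (auto simp: tor_cycles_extend)
    show "mat_map ?p ?q ?P z \<in> tens X (Suc i) j"
      by (rule tens_mat_map[OF h\<Phi> z'(1)])
    show "z - mat_map ?q ?p ?Q (mat_map ?p ?q ?P z) \<in> tor_boundaries F i j"
      using homotopic_modulo_boundaries[OF F chain_map_comp[OF \<Phi> \<Psi> r(1,2,1)] z']
      by (simp add: comp tor_boundaries_extend del: extend_simps)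
  next
    fix z assume "z \<in> tor_boundaries F i j"
    then obtain y where "z = tens_diff ?E (Suc i) y"
      by (auto simp: tor_boundaries_extend)
    then show "mat_map ?p ?q ?P z = 0"
      using tens_diff_chain_map[OF \<Phi>, of "Suc i" y] by (simp add: minimal_tens_diff[OF m] del: extend_simps)
  next
    fix w assume w: "w \<in> tens X (Suc i) j"
    have "tens_diff ?E i (mat_map ?q ?p ?Q w) = 0"
      unfolding tens_diff_chain_map[OF \<Psi>] minimal_tens_diff[OF m] by simp
    then show "mat_map ?q ?p ?Q w \<in> tor_cycles F i j"
      using tens_mat_map[OF h\<Psi> w] by (simp add: tor_cycles_extend)
    have "w - mat_map ?p ?q ?P (mat_map ?q ?p ?Q w) \<in> tens_diff X (Suc i) ` tens X (Suc (Suc i)) j"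
      using homotopic_modulo_boundaries[OF X chain_map_comp[OF \<Psi> \<Phi> r(2,1,2)] w]
      by (simp add: comp minimal_tens_diff[OF m] del: extend_simps)
    then show "mat_map ?p ?q ?P (mat_map ?q ?p ?Q w) = w"
      by (auto simp: minimal_tens_diff[OF m])
  qed
qed

text \<open>\<open>P z\<close> lies in a zero space, so each cycle \<open>z\<close> equals
  \<open>z - Q (P z)\<close> and is a boundary.\<close>

lemma tor_dim_eq_0:
  assumes F: "quot_resolution n J (extend F)" and X: "quot_resolution n J X" and m: "minimal_complex X"
    and none: "\<And>b. b < rk X (Suc i) \<Longrightarrow> shift X (Suc i) b \<noteq> j"
  shows "tor_dim F i j = 0"
proof -
  obtain p q P Q where 1: "\<And>z. z \<in> tor_cycles F i j \<Longrightarrow> mat_map p q P z \<in> tens X (Suc i) j"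
    and 2: "\<And>z. z \<in> tor_cycles F i j \<Longrightarrow>
      z - mat_map q p Q (mat_map p q P z) \<in> tor_boundaries F i j"
    using tor_comparison[OF F X m, of i j] by blast
  have "tens X (Suc i) j = {0}" using none unfolding tens_def by fastforce
  with 1 2 have "tor_cycles F i j \<subseteq> tor_boundaries F i j" by fastforce
  then have "tor_cycles F i j = tor_boundaries F i j"
    using boundaries_subset_cycles[OF F] by blast
  then show ?thesis by (simp add: tor_dim_def)
qed

text \<open>Let \<open>e\<close> span the line \<open>tens X (Suc i) j\<close>. Adding
  \<open>a = Q e\<close> to a basis of the boundaries gives a basis of the cycles: \<open>a\<close>
  is not a boundary because \<open>P a = e\<close>, and every cycle differs from a multiple of
  \<open>a\<close> by a boundary.\<close>

lemma tor_dim_eq_1: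
  fixes F X :: "'k::field gcomplex"
  assumes F: "quot_resolution n J (extend F)" and X: "quot_resolution n J X" and m: "minimal_complex X"
    and one: "rk X (Suc i) = 1" "shift X (Suc i) 0 = j"
  shows "tor_dim F i j = 1"
proof -
  let ?Z = "tor_cycles F i j" and ?B = "tor_boundaries F i j"
  interpret V: vector_space "\<lambda>(a::'k) v (b::nat). a * v b"
    by unfold_locales (auto simp: fun_eq_iff algebra_simps)
  obtain p q P Q where 1: "\<And>z. z \<in> ?Z \<Longrightarrow> mat_map p q P z \<in> tens X (Suc i) j"
    and 2: "\<And>z. z \<in> ?Z \<Longrightarrow> z - mat_map q p Q (mat_map p q P z) \<in> ?B"
    and 3: "\<And>z. z \<in> ?B \<Longrightarrow> mat_map p q P z = 0"
    and 4: "\<And>w. w \<in> tens X (Suc i) j \<Longrightarrow> mat_map q p Q w \<in> ?Z"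
    and 5: "\<And>w. w \<in> tens X (Suc i) j \<Longrightarrow> mat_map p q P (mat_map q p Q w) = w"
    using tor_comparison[OF F X m, of i j] by blast
  define e where "e = (id_mat 0 :: nat \<Rightarrow> 'k)"
  define a where "a = mat_map q p Q e"
  have e: "e \<in> tens X (Suc i) j" using one by (auto simp: tens_def e_def id_mat_def)
  have T: "w = (\<lambda>b. w 0 * e b)" if "w \<in> tens X (Suc i) j" for w
    using that one by (auto simp: tens_def fun_eq_iff e_def id_mat_def)
  have aZ: "a \<in> ?Z" using 4[OF e] by (simp add: a_def)
  have aB: "a \<notin> ?B"
  proof
    assume "a \<in> ?B"
    then have "e = 0" using 3 5[OF e] by (simp add: a_def)
    then have "e 0 = 0" by simp
    then show False by (simp add: e_def id_mat_def)
  qed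
  have tens: "V.subspace (tens G k j)" for G :: "'k gcomplex" and k
    by (auto simp: V.subspace_def tens_def) (metis add.left_neutral)+
  have "tens_diff (extend F) i (\<lambda>b. c * x b) = 0" if "tens_diff (extend F) i x = 0" for c x
    using that unfolding tens_diff_def by (simp add: mat_map_scale fun_eq_iff)
  then have Z: "V.subspace ?Z"
    using tens[of "extend F" "Suc i"]
    by (auto simp: V.subspace_def tor_cycles_extend tens_diff_def mat_map_add)
  have B: "V.subspace ?B"
    unfolding V.subspace_def
  proof (intro conjI ballI allI)
    let ?T = "tens (extend F) (Suc (Suc i)) j"
    show "0 \<in> ?B"
      unfolding tor_boundaries_extend
      by (rule image_eqI[of _ _ 0]) (use tens in \<open>auto simp: V.subspace_def tens_diff_def\<close>)
    fix x y assume "x \<in> ?B" "y \<in> ?B"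
    then obtain x' y' where xy: "x' \<in> ?T" "y' \<in> ?T"
      "x = tens_diff (extend F) (Suc i) x'" "y = tens_diff (extend F) (Suc i) y'"
      by (auto simp: tor_boundaries_extend)
    show "x + y \<in> ?B"
      unfolding tor_boundaries_extend
      by (rule image_eqI[of _ _ "x' + y'"])
        (use tens xy in \<open>auto simp: V.subspace_def tens_diff_def mat_map_add\<close>)
  next
    let ?T = "tens (extend F) (Suc (Suc i)) j"
    fix c x assume "x \<in> ?B"
    then obtain x' where x: "x' \<in> ?T" "x = tens_diff (extend F) (Suc i) x'"
      by (auto simp: tor_boundaries_extend)
    show "(\<lambda>b. c * x b) \<in> ?B"
      unfolding tor_boundaries_extend
      by (rule image_eqI[of _ _ "\<lambda>b. c * x' b"])
        (use tens x in \<open>auto simp: V.subspace_def tens_diff_def mat_map_scale\<close>)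
  qed
  obtain S where S: "S \<subseteq> ?B" "V.independent S" "?B \<subseteq> V.span S" "card S = V.dim ?B"
    using V.basis_exists by blast
  have span: "V.span S = ?B"
    using S B by (metis V.span_minimal subset_antisym)
  \<comment> \<open>\<open>card\<close> is 0 on infinite sets, so counting one more basis vector
    needs finiteness; the ambient space is spanned by finitely many \<open>id_mat b\<close>.\<close>
  have fin: "finite S"
  proof -
    let ?N = "rk (extend F) (Suc i)"
    have "S \<subseteq> V.span (id_mat ` {..<?N})"
    proof
      fix v assume "v \<in> S"
      then have v: "v \<in> tens (extend F) (Suc i) j"
        using S(1) boundaries_subset_cycles[OF F, of i j] by (auto simp: tor_cycles_extend)
      have "v = (\<Sum>b<?N. (\<lambda>c. v b * id_mat b c))"
      proof
        fix c
        have "(\<Sum>b<N. (\<lambda>c. v b * id_mat b c)) c = (\<Sum>b<N. v b * id_mat b c)" for N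
          by (induction N) auto
        then have "(\<Sum>b<?N. (\<lambda>c. v b * id_mat b c)) c = (\<Sum>b<?N. v b * id_mat b c)" .
        also have "\<dots> = (\<Sum>b<?N. if b = c then v b else 0)"
          by (intro sum.cong) (auto simp: id_mat_def)
        also have "\<dots> = v c" using v by (auto simp: tens_def)
        finally show "v c = (\<Sum>b<?N. (\<lambda>c. v b * id_mat b c)) c" ..
      qed
      also have "\<dots> \<in> V.span (id_mat ` {..<?N})"
        by (intro V.span_sum V.span_scale V.span_base) auto
      finally show "v \<in> V.span (id_mat ` {..<?N})" .
    qed
    then show ?thesis
      using V.independent_span_bound[of "id_mat ` {..<?N}" S] S(2) by blast
  qed
  have aS: "a \<notin> V.span S" using aB span by simp
  then have "V.independent (insert a S)" using S(2) by (rule V.independent_insertI)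
  moreover have "V.span (insert a S) = ?Z"
  proof
    show "V.span (insert a S) \<subseteq> ?Z"
      using aZ S(1) boundaries_subset_cycles[OF F] Z by (intro V.span_minimal) auto
    show "?Z \<subseteq> V.span (insert a S)"
    proof
      fix z assume z: "z \<in> ?Z"
      let ?w = "mat_map p q P z"
      have "mat_map q p Q ?w = mat_map q p Q (\<lambda>b. ?w 0 * e b)"
        using T[OF 1[OF z]] by (rule arg_cong)
      also have "\<dots> = (\<lambda>b. ?w 0 * a b)" by (simp add: mat_map_scale a_def)
      finally have "z - (\<lambda>b. ?w 0 * a b) \<in> V.span S"
        using 2[OF z] span by simp
      then show "z \<in> V.span (insert a S)"
        by (auto simp: V.span_breakdown_eq)
    qed
  qed
  ultimately have "V.dim ?Z = card (insert a S)"
    by (metis V.dim_eq_card V.span_eq_iff Z)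
  also have "\<dots> = Suc (V.dim ?B)"
    using fin aS S(4) V.span_base by (subst card_insert_disjoint) auto
  finally show ?thesis by (simp add: tor_dim_def)
qed

section \<open>Multiplication by a linear form and its mapping cone\<close>

text \<open>
  In the Betti table of \<open>A/I\<close> the entry in column \<open>k\<close> and row \<open>l\<close> is \<open>1\<close>, and everything to the right
  of it or below it vanishes.
\<close>

definition single_corner :: "'k::field gcomplex \<Rightarrow> nat \<Rightarrow> nat \<Rightarrow> bool" where
  "single_corner X k l \<longleftrightarrow> rk X k = 1 \<and> shift X k 0 = int (k + l) \<and> (\<forall>i>k. rk X i = 0) \<and>
     (\<forall>i. \<forall>b<rk X i. shift X i b \<le> int (i + l))"

definition has_corner :: "nat \<Rightarrow> 'k::field mpoly set \<Rightarrow> nat \<Rightarrow> nat \<Rightarrow> bool" where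
  "has_corner n J k l \<longleftrightarrow> (\<exists>X. quot_resolution n J X \<and> minimal_complex X \<and> single_corner X k l)"

text \<open>Start of the induction: \<open>A\<close> alone resolves \<open>A/0\<close>.\<close>

lemma has_corner_zero: "has_corner n ({0} :: 'k::field mpoly set) 0 0"
proof -
  define X :: "'k gcomplex" where
    "X = \<lparr>rk = \<lambda>i. if i = 0 then 1 else 0, shift = \<lambda>_ _. 0, diff = \<lambda>_ _ _. 0, aug = \<lambda>_. 0\<rparr>"
  have fm0: "free_mod n 0 = {0 :: nat \<Rightarrow> 'k mpoly}"
    by (auto simp: free_mod_def)
  have "{v \<in> free_mod n 1. v 0 = (0 :: 'k mpoly)} = {0}"
    using free_mod_1_eq[of n "{0 :: 'k mpoly}"] by (auto simp: fun_eq_iff)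
  moreover have "res_diff X i = (\<lambda>_. 0)" for i
    by (auto simp: res_diff_def X_def mat_map_def fun_eq_iff)
  ultimately have "quot_resolution n {0} X"
    unfolding quot_resolution_def by (auto simp: X_def fm0)
  moreover have "minimal_complex X" "single_corner X 0 0"
    by (auto simp: minimal_complex_def single_corner_def X_def)
  ultimately show ?thesis unfolding has_corner_def by blast
qed

text \<open>\<open>x\<close> is a nonzerodivisor, so scaling the map to \<open>A\<close> by
  \<open>x\<close> keeps its kernel, and all other differentials stay. Shifts grow by one except in
  position 0, where \<open>A\<close> keeps degree 0; therefore the corner moves to the next row only
  if it sits at \<open>k > 0\<close>.\<close>

lemma has_corner_mult:
  fixes J :: "'k::field mpoly set"
  assumes J: "has_corner n J k l" "J \<subseteq> pcar n" and k: "k > 0"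
    and x: "x \<in> pcar n" "homogeneous x 1" "x \<noteq> 0"
  shows "has_corner n ((*) x ` J) k (Suc l)"
proof -
  obtain X where X: "quot_resolution n J X" and m: "minimal_complex X" and c: "single_corner X k l"
    using J(1) unfolding has_corner_def by blast
  note g = X[unfolded quot_resolution_def]
  define Y :: "'k gcomplex" where
    "Y = \<lparr>rk = rk X, shift = \<lambda>i b. if i = 0 then 0 else shift X i b + 1,
       diff = \<lambda>i b c. if i = 0 then x * diff X i b c else diff X i b c, aug = \<lambda>_. 0\<rparr>"
  have rkY: "rk Y = rk X" by (simp add: Y_def)
  have r0: "rk X 0 = 1" "shift X 0 0 = 0" using g by auto
  have D0: "res_diff Y 0 v = (\<lambda>c. x * res_diff X 0 v c)" for v
    by (auto simp: res_diff_def Y_def mat_map_def fun_eq_iff sum_distrib_left mult_ac)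
  have DS: "res_diff Y (Suc i) = res_diff X (Suc i)" for i
    by (simp add: res_diff_def Y_def fun_eq_iff)
  have "quot_resolution n ((*) x ` J) Y"
    unfolding quot_resolution_def
  proof (intro conjI)
    show "\<forall>i. \<forall>b<rk Y (Suc i). \<forall>c<rk Y i. diff Y i b c \<in> pcar n \<and>
        homogeneous (diff Y i b c) (shift Y (Suc i) b - shift Y i c)"
    proof (intro allI impI)
      fix i b c assume bc: "b < rk Y (Suc i)" "c < rk Y i"
      then have d: "diff X i b c \<in> pcar n" "homogeneous (diff X i b c) (shift X (Suc i) b - shift X i c)"
        using g by (auto simp: rkY)
      show "diff Y i b c \<in> pcar n \<and> homogeneous (diff Y i b c) (shift Y (Suc i) b - shift Y i c)"
      proof (cases "i = 0")
        case True
        then show ?thesis using d bc x r0 by (auto simp: Y_def intro: homogeneous_mult[OF x(2)])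
      qed (use d in \<open>simp add: Y_def\<close>)
    qed
    have "{v \<in> free_mod n 1. v 0 \<in> (*) x ` J}
        = (\<lambda>v c. x * v c) ` (\<lambda>p c. if c = 0 then p else 0) ` (J \<inter> pcar n)"
    proof -
      have "(*) x ` J \<inter> pcar n = (*) x ` (J \<inter> pcar n)"
        using J(2) x(1) by auto
      then show ?thesis
        unfolding free_mod_1_eq by (simp add: image_image if_distrib cong: if_cong)
    qed
    also have "\<dots> = (\<lambda>v c. x * v c) ` res_diff X 0 ` free_mod n (rk X 1)"
      using g by (simp only: free_mod_1_eq[symmetric])
    also have "\<dots> = res_diff Y 0 ` free_mod n (rk Y 1)"
      by (simp add: image_image D0 rkY)
    finally show "{v \<in> free_mod n 1. v 0 \<in> (*) x ` J} = res_diff Y 0 ` free_mod n (rk Y 1)" .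
    show "\<forall>i. {v \<in> free_mod n (rk Y (Suc i)). res_diff Y i v = 0} =
        res_diff Y (Suc i) ` free_mod n (rk Y (Suc (Suc i)))"
    proof
      fix i
      have "res_diff Y i v = 0 \<longleftrightarrow> res_diff X i v = 0" for v
        using x(3) by (cases i) (auto simp: D0 DS fun_eq_iff)
      moreover have "{v \<in> free_mod n (rk X (Suc i)). res_diff X i v = 0} =
        res_diff X (Suc i) ` free_mod n (rk X (Suc (Suc i)))"
        using g by blast
      ultimately show "{v \<in> free_mod n (rk Y (Suc i)). res_diff Y i v = 0} =
        res_diff Y (Suc i) ` free_mod n (rk Y (Suc (Suc i)))"
        by (simp add: rkY DS)
    qed
  qed (use r0 in \<open>auto simp: Y_def\<close>)
  moreover have "minimal_complex Y"
    using m by (auto simp: minimal_complex_def Y_def const_coeff_mult)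
  moreover have "single_corner Y k (Suc l)"
    unfolding single_corner_def
  proof (intro conjI allI impI)
    show "shift Y k 0 = int (k + Suc l)" using c k by (auto simp: single_corner_def Y_def)
    fix i b assume "b < rk Y i"
    then have "shift X i b \<le> int (i + l)" using c by (auto simp: single_corner_def rkY)
    then show "shift Y i b \<le> int (i + Suc l)" by (simp add: Y_def)
  qed (use c in \<open>auto simp: single_corner_def rkY\<close>)
  ultimately show ?thesis unfolding has_corner_def by blast
qed

section \<open>Concatenated vectors and the mapping cone\<close>

definition vjoin :: "nat \<Rightarrow> (nat \<Rightarrow> 'r) \<Rightarrow> (nat \<Rightarrow> 'r) \<Rightarrow> nat \<Rightarrow> 'r" where
  "vjoin r u w = (\<lambda>b. if b < r then u b else w (b - r))"

lemma vjoin_free_mod: "u \<in> free_mod n r \<Longrightarrow> w \<in> free_mod n q \<Longrightarrow> vjoin r u w \<in> free_mod n (r + q)"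
  by (auto simp: free_mod_def vjoin_def)

lemma free_mod_add_cases:
  assumes "v \<in> free_mod n (r + q)"
  obtains u w where "v = vjoin r u w" "u \<in> free_mod n r" "w \<in> free_mod n q"
proof
  show "v = vjoin r (\<lambda>b. if b < r then v b else 0) (\<lambda>b. v (b + r))"
    by (auto simp: vjoin_def fun_eq_iff)
qed (use assms in \<open>auto simp: free_mod_def\<close>)

lemma vjoin_eq_0D:
  assumes "vjoin r u w = 0" "u \<in> free_mod n r"
  shows "u = 0" "w = 0"
proof -
  have 0: "vjoin r u w b = 0" for b using assms(1) by simp
  show "u = 0"
  proof
    fix b show "u b = 0 b" using 0[of b] assms(2) by (cases "b < r") (auto simp: vjoin_def free_mod_def)
  qed
  show "w = 0"
  proof
    fix b show "w b = 0 b" using 0[of "b + r"] by (simp add: vjoin_def)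
  qed
qed

lemma vjoin_0 [simp]: "vjoin r 0 0 = 0"
  by (auto simp: vjoin_def)

lemma sum_lessThan_add: "(\<Sum>b<r + q. f b) = (\<Sum>b<r. f b) + (\<Sum>b<q. f (b + r))"
  for f :: "nat \<Rightarrow> 'a::comm_monoid_add"
  by (induction q) (auto simp: ac_simps)

text \<open>
  The mapping cone of multiplication by \<open>x\<close> on a complex. In position \<open>i + 1\<close> it is
  \<open>X\<^bsub>i+1\<^esub> \<oplus> X\<^sub>i(-1)\<close>, with differential \<open>(u, w) \<mapsto> (d u + x w, - d w)\<close>; with the sign placed
  on \<open>d w\<close> instead of \<open>x w\<close>, it does not depend on \<open>i\<close>.
\<close>

definition cone :: "'k::field mpoly \<Rightarrow> 'k gcomplex \<Rightarrow> 'k gcomplex" where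
  "cone x X = \<lparr>rk = \<lambda>i. case i of 0 \<Rightarrow> rk X 0 | Suc j \<Rightarrow> rk X (Suc j) + rk X j,
     shift = \<lambda>i. case i of 0 \<Rightarrow> shift X 0
       | Suc j \<Rightarrow> vjoin (rk X (Suc j)) (shift X (Suc j)) (\<lambda>b. shift X j b + 1),
     diff = \<lambda>i. vjoin (rk X (Suc i))
       (\<lambda>b c. if c < rk X i then diff X i b c else 0)
       (\<lambda>b. vjoin (rk X i) (\<lambda>c. if c = b then x else 0) (\<lambda>c. - diff X (i - 1) b c)),
     aug = \<lambda>_. 0\<rparr>"

lemma cone_simps:
  "rk (cone x X) 0 = rk X 0" "rk (cone x X) (Suc i) = rk X (Suc i) + rk X i"
  "shift (cone x X) 0 = shift X 0"
  "shift (cone x X) (Suc i) = vjoin (rk X (Suc i)) (shift X (Suc i)) (\<lambda>b. shift X i b + 1)"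
  "diff (cone x X) i = vjoin (rk X (Suc i))
       (\<lambda>b c. if c < rk X i then diff X i b c else 0)
       (\<lambda>b. vjoin (rk X i) (\<lambda>c. if c = b then x else 0) (\<lambda>c. - diff X (i - 1) b c))"
  by (simp_all add: cone_def)

lemma res_diff_cone_lt:
  assumes "c < rk X i"
  shows "res_diff (cone x X) i (vjoin (rk X (Suc i)) u w) c = res_diff X i u c + x * w c"
proof -
  have "c < rk (cone x X) i" using assms by (cases i) (auto simp: cone_simps)
  then have "res_diff (cone x X) i (vjoin (rk X (Suc i)) u w) c =
      (\<Sum>b<rk X (Suc i). u b * diff X i b c) + (\<Sum>b<rk X i. w b * (if c = b then x else 0))"
    using assms by (simp add: res_diff_def mat_map_def cone_simps sum_lessThan_add vjoin_def)
  also have "(\<Sum>b<rk X i. w b * (if c = b then x else 0)) = x * w c"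
    using assms by (simp add: if_distrib mult.commute cong: if_cong)
  finally show ?thesis using assms by (simp add: res_diff_def mat_map_def)
qed

lemma res_diff_cone_ge:
  "res_diff (cone x X) (Suc i) (vjoin (rk X (Suc (Suc i))) u w) (c + rk X (Suc i)) = - res_diff X i w c"
  by (auto simp: res_diff_def mat_map_def cone_simps sum_lessThan_add vjoin_def sum_negf)

text \<open>Position 0 of the cone is that of \<open>X\<close>, with no second block, so
  \<open>w\<close> enters only through \<open>x w\<close>.\<close>

lemma res_diff_cone_0:
  assumes "w \<in> free_mod n (rk X 0)"
  shows "res_diff (cone x X) 0 (vjoin (rk X (Suc 0)) u w) = res_diff X 0 u + (\<lambda>c. x * w c)"
proof
  fix c show "res_diff (cone x X) 0 (vjoin (rk X (Suc 0)) u w) c = (res_diff X 0 u + (\<lambda>c. x * w c)) c"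
  proof (cases "c < rk X 0")
    case False
    then show ?thesis using free_mod_zero[OF assms, of c]
      by (simp add: res_diff_def mat_map_def cone_simps)
  qed (simp add: res_diff_cone_lt)
qed

lemma res_diff_cone_Suc:
  "res_diff (cone x X) (Suc i) (vjoin (rk X (Suc (Suc i))) u w) =
    vjoin (rk X (Suc i)) (res_diff X (Suc i) u + (\<lambda>c. x * w c)) (- res_diff X i w)"
proof
  fix c show "res_diff (cone x X) (Suc i) (vjoin (rk X (Suc (Suc i))) u w) c =
    vjoin (rk X (Suc i)) (res_diff X (Suc i) u + (\<lambda>c. x * w c)) (- res_diff X i w) c"
    using res_diff_cone_ge[of x X i u w "c - rk X (Suc i)"]
    by (cases "c < rk X (Suc i)") (simp_all add: res_diff_cone_lt vjoin_def[of "rk X (Suc i)"])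
qed

text \<open>\<open>regular\<close> says that \<open>x\<close> acts injectively on the quotient by
  \<open>J\<close>, so the cone resolves the quotient by \<open>J + (x)\<close>. The last module of
  \<open>X\<close>, twisted by one, moves to position \<open>Suc k\<close> with degree
  \<open>k + l + 1\<close>, hence stays in row \<open>l\<close>.\<close>

lemma has_corner_cone:
  fixes J :: "'k::field mpoly set"
  assumes J: "has_corner n J k l" "J \<subseteq> pcar n"
    and x: "x \<in> pcar n" "homogeneous x 1"
    and regular: "\<And>f. f \<in> pcar n \<Longrightarrow> x * f \<in> J \<Longrightarrow> f \<in> J"
  shows "has_corner n {f + x * h |f h. f \<in> J \<and> h \<in> pcar n} (Suc k) l"
proof -
  obtain X where X: "quot_resolution n J X" and m: "minimal_complex X" and c: "single_corner X k l"
    using J(1) unfolding has_corner_def by blast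
  note g = X[unfolded quot_resolution_def]
  let ?Y = "cone x X" and ?J' = "{f + x * h |f h. f \<in> J \<and> h \<in> pcar n}"
  have r0: "rk X 0 = 1" "shift X 0 0 = 0" using g by auto
  have exact: "{v \<in> free_mod n (rk X (Suc i)). res_diff X i v = 0} =
        res_diff X (Suc i) ` free_mod n (rk X (Suc (Suc i)))" for i
    using g by blast
  have im0: "{v \<in> free_mod n 1. v 0 \<in> J} = res_diff X 0 ` free_mod n (rk X 1)"
    using g by blast
  have Dadd: "res_diff X i (u + w) = res_diff X i u + res_diff X i w"
    and Dneg: "res_diff X i (- u) = - res_diff X i u"
    and Dx: "res_diff X i (\<lambda>c. x * u c) = (\<lambda>c. x * res_diff X i u c)" for i u w
    by (simp_all add: res_diff_def mat_map_add mat_map_uminus mat_map_scale)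
  have D0: "res_diff X i 0 = 0" for i by (simp add: res_diff_def)
  have fmx: "(\<lambda>c. x * w c) \<in> free_mod n r" if "w \<in> free_mod n r" for w r
    using that x by (auto simp: free_mod_def)
  have fmneg: "- w \<in> free_mod n r" if "w \<in> free_mod n r" for w :: "nat \<Rightarrow> 'k mpoly" and r
    using that by (auto simp: free_mod_def)
  have "quot_resolution n ?J' ?Y"
    unfolding quot_resolution_def
  proof (intro conjI)
    show "\<forall>i. \<forall>b<rk ?Y (Suc i). \<forall>c<rk ?Y i. diff ?Y i b c \<in> pcar n \<and>
        homogeneous (diff ?Y i b c) (shift ?Y (Suc i) b - shift ?Y i c)"
    proof (intro allI impI)
      fix i b c assume bc: "b < rk ?Y (Suc i)" "c < rk ?Y i"
      have g': "diff X i b c \<in> pcar n" "homogeneous (diff X i b c) (shift X (Suc i) b - shift X i c)"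
        if "b < rk X (Suc i)" "c < rk X i" for i b c
        using g that by auto
      show "diff ?Y i b c \<in> pcar n \<and> homogeneous (diff ?Y i b c) (shift ?Y (Suc i) b - shift ?Y i c)"
      proof (cases i)
        case 0
        then show ?thesis using bc x g' by (auto simp: cone_simps vjoin_def)
      next
        case (Suc j)
        have "shift X (Suc j) (b - rk X (Suc (Suc j))) + 1 - (shift X j (c - rk X (Suc j)) + 1)
          = shift X (Suc j) (b - rk X (Suc (Suc j))) - shift X j (c - rk X (Suc j))" by simp
        then show ?thesis using bc x g' unfolding Suc by (auto simp: cone_simps vjoin_def)
      qed
    qed
    show "{v \<in> free_mod n 1. v 0 \<in> ?J'} = res_diff ?Y 0 ` free_mod n (rk ?Y 1)"
    proof (intro equalityI subsetI)
      fix v assume v: "v \<in> {v \<in> free_mod n 1. v 0 \<in> ?J'}"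
      then obtain f h where fh: "v 0 = f + x * h" "f \<in> J" "h \<in> pcar n" by auto
      define f' h' :: "nat \<Rightarrow> 'k mpoly" where "f' = (\<lambda>c. if c = 0 then f else 0)" and "h' = (\<lambda>c. if c = 0 then h else 0)"
      have "f' \<in> {v \<in> free_mod n 1. v 0 \<in> J}" and h: "h' \<in> free_mod n (rk X 0)"
        using fh J(2) r0 by (auto simp: f'_def h'_def free_mod_def)
      then obtain u where u: "u \<in> free_mod n (rk X 1)" "f' = res_diff X 0 u"
        unfolding im0 by blast
      have "v = res_diff ?Y 0 (vjoin (rk X (Suc 0)) u h')"
        using v fh unfolding res_diff_cone_0[OF h] u(2)[symmetric]
        by (auto simp: fun_eq_iff f'_def h'_def free_mod_def)
      then show "v \<in> res_diff ?Y 0 ` free_mod n (rk ?Y 1)"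
        using vjoin_free_mod[OF u(1) h] by (auto simp: cone_simps)
    next
      fix v assume "v \<in> res_diff ?Y 0 ` free_mod n (rk ?Y 1)"
      then obtain u w where uw: "u \<in> free_mod n (rk X (Suc 0))" "w \<in> free_mod n (rk X 0)"
        "v = res_diff ?Y 0 (vjoin (rk X (Suc 0)) u w)"
        by (auto simp: cone_simps elim: free_mod_add_cases)
      have Du: "res_diff X 0 u \<in> {v \<in> free_mod n 1. v 0 \<in> J}"
        unfolding im0 using uw(1) by simp
      have "w 0 \<in> pcar n" using free_mod_D[OF uw(2)] r0 by simp
      then have "res_diff X 0 u 0 + x * w 0 \<in> ?J'"
        using Du by blast
      then show "v \<in> {v \<in> free_mod n 1. v 0 \<in> ?J'}"
        using Du fmx[OF uw(2)] r0 unfolding uw(3) res_diff_cone_0[OF uw(2)]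
        by (simp add: free_mod_add)
    qed
    show "\<forall>i. {v \<in> free_mod n (rk ?Y (Suc i)). res_diff ?Y i v = 0} =
        res_diff ?Y (Suc i) ` free_mod n (rk ?Y (Suc (Suc i)))"
    proof (intro allI equalityI subsetI)
      fix i v assume "v \<in> res_diff ?Y (Suc i) ` free_mod n (rk ?Y (Suc (Suc i)))"
      then obtain u w where u: "u \<in> free_mod n (rk X (Suc (Suc i)))" and w: "w \<in> free_mod n (rk X (Suc i))"
        and v: "v = res_diff ?Y (Suc i) (vjoin (rk X (Suc (Suc i))) u w)"
        by (auto simp: cone_simps elim: free_mod_add_cases)
      let ?u = "res_diff X (Suc i) u + (\<lambda>c. x * w c)" and ?w = "- res_diff X i w"
      have v: "v = vjoin (rk X (Suc i)) ?u ?w"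
        unfolding v res_diff_cone_Suc ..
      have u': "?u \<in> free_mod n (rk X (Suc i))" and w': "?w \<in> free_mod n (rk X i)"
        using res_diff_free_mod[OF X u] fmx[OF w] fmneg[OF res_diff_free_mod[OF X w]]
        by (auto intro: free_mod_add)
      have 0: "res_diff X i ?u + (\<lambda>c. x * ?w c) = 0"
        by (auto simp: Dadd Dx res_diff_res_diff[OF X])
      have "res_diff ?Y i v = 0"
      proof (cases i)
        case 0
        then show ?thesis using res_diff_cone_0[of ?w n X x ?u] w' \<open>res_diff X i ?u + _ = 0\<close> unfolding v by simp
      next
        case (Suc j)
        have "- res_diff X j ?w = 0" unfolding Suc by (simp add: Dneg res_diff_res_diff[OF X])
        then show ?thesis using res_diff_cone_Suc[of x X j ?u ?w] 0 unfolding v Suc by simp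
      qed
      then show "v \<in> {v \<in> free_mod n (rk ?Y (Suc i)). res_diff ?Y i v = 0}"
        using vjoin_free_mod[OF u' w'] v by (simp add: cone_simps)
    next
      fix i v assume "v \<in> {v \<in> free_mod n (rk ?Y (Suc i)). res_diff ?Y i v = 0}"
      then obtain u w where u: "u \<in> free_mod n (rk X (Suc i))" and w: "w \<in> free_mod n (rk X i)"
        and v: "v = vjoin (rk X (Suc i)) u w" and v0: "res_diff ?Y i v = 0"
        by (auto simp: cone_simps elim: free_mod_add_cases)
      \<comment> \<open>The second component of a kernel element is a boundary: for
        \<open>i > 0\<close> by exactness of \<open>X\<close>. For \<open>i = 0\<close> there is no
        lower differential, and regularity replaces it: \<open>x w\<close> lies in the image
        \<open>J\<close>, hence so does \<open>w\<close>.\<close>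
      have "res_diff X i u + (\<lambda>c. x * w c) = 0 \<and> w \<in> res_diff X i ` free_mod n (rk X (Suc i))"
      proof (cases i)
        case 0
        have eq: "res_diff X 0 u + (\<lambda>c. x * w c) = 0"
          using v0 res_diff_cone_0[of w n X x u] w unfolding v 0 by simp
        then have "(\<lambda>c. x * w c) = res_diff X 0 (- u)"
          by (simp add: Dneg eq_neg_iff_add_eq_0 add.commute)
        also have "\<dots> \<in> {v \<in> free_mod n 1. v 0 \<in> J}"
          unfolding im0 using fmneg[OF u] 0 by simp
        finally have "w \<in> {v \<in> free_mod n 1. v 0 \<in> J}"
          using regular[of "w 0"] w r0 0 by (auto simp: free_mod_D)
        then show ?thesis using eq 0 unfolding im0 by simp
      next
        case (Suc j)
        have "vjoin (rk X (Suc j)) (res_diff X (Suc j) u + (\<lambda>c. x * w c)) (- res_diff X j w) = 0"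
          using v0 unfolding v Suc res_diff_cone_Suc .
        moreover have "res_diff X (Suc j) u + (\<lambda>c. x * w c) \<in> free_mod n (rk X (Suc j))"
          using u w unfolding Suc by (intro free_mod_add fmx res_diff_free_mod[OF X])
        ultimately have "res_diff X (Suc j) u + (\<lambda>c. x * w c) = 0" "- res_diff X j w = 0"
          by (rule vjoin_eq_0D)+
        then show ?thesis using exact[of j] w unfolding Suc by auto
      qed
      then obtain w' where eq: "res_diff X i u + (\<lambda>c. x * w c) = 0"
        and w': "w' \<in> free_mod n (rk X (Suc i))" "w = res_diff X i w'"
        by auto
      \<comment> \<open>Subtracting the image of \<open>(0, - w')\<close>, which is
        \<open>(- x w', w)\<close>, leaves a cycle of \<open>X\<close> in the first
        component.\<close>
      have "u + (\<lambda>c. x * w' c) \<in> {v \<in> free_mod n (rk X (Suc i)). res_diff X i v = 0}"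
        using eq u fmx[OF w'(1)] by (auto simp: Dadd Dx w'(2) free_mod_add)
      then obtain u' where u': "u' \<in> free_mod n (rk X (Suc (Suc i)))"
        "u + (\<lambda>c. x * w' c) = res_diff X (Suc i) u'"
        unfolding exact by auto
      have "u = res_diff X (Suc i) u' + (\<lambda>c. x * (- w') c)"
        using u'(2) by (auto simp: fun_eq_iff algebra_simps)
      then have "v = res_diff ?Y (Suc i) (vjoin (rk X (Suc (Suc i))) u' (- w'))"
        unfolding v res_diff_cone_Suc w'(2) Dneg by simp
      then show "v \<in> res_diff ?Y (Suc i) ` free_mod n (rk ?Y (Suc (Suc i)))"
        using vjoin_free_mod[OF u'(1) fmneg[OF w'(1)]] by (auto simp: cone_simps)
    qed
  qed (use r0 in \<open>simp_all add: cone_simps\<close>)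
  moreover have "minimal_complex ?Y"
  proof -
    have "const_coeff x = 0" using homogeneous_const_coeff[OF x(2)] by auto
    then have "const_coeff (diff ?Y i b c) = 0" if "b < rk ?Y (Suc i)" "c < rk ?Y i" for i b c
      using m that by (cases i) (auto simp: minimal_complex_def cone_simps vjoin_def)
    then show ?thesis by (simp add: minimal_complex_def)
  qed
  moreover have "single_corner ?Y (Suc k) l"
    unfolding single_corner_def
  proof (intro conjI allI impI)
    have bound: "shift X i b \<le> int (i + l)" if "b < rk X i" for i b
      using c that by (simp add: single_corner_def)
    fix i
    show "shift ?Y i b \<le> int (i + l)" if "b < rk ?Y i" for b
    proof (cases i)
      case 0
      then show ?thesis using that bound[of b 0] by (simp add: cone_simps)
    next
      case (Suc j)
      then show ?thesis using that bound[of b "Suc j"] bound[of "b - rk X (Suc j)" j]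
        by (auto simp: cone_simps vjoin_def)
    qed
    show "rk ?Y i = 0" if "Suc k < i"
      using c that by (cases i) (auto simp: cone_simps single_corner_def)
  qed (use c in \<open>auto simp: cone_simps single_corner_def vjoin_def\<close>)
  ultimately show ?thesis unfolding has_corner_def by blast
qed

section \<open>Squarefree monomial ideals\<close>

abbreviation mvar :: "nat \<Rightarrow> 'k::field mpoly" where
  "mvar p \<equiv> monomial (Poly_Mapping.single p (Suc 0))"

lemma lookup_monomial_mult: "Poly_Mapping.lookup (monomial e * h) (e + m) = Poly_Mapping.lookup h m"
proof -
  have "(\<Sum>q. Poly_Mapping.lookup h q when e + m = e + q) = Poly_Mapping.lookup h m"
    using Sum_any_when_equal'[of "Poly_Mapping.lookup h" m] by simp
  then show ?thesis
    by (simp add: lookup_mult monomial_def lookup_single when_mult)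
qed

lemma in_keys_monomial_mult: "e + m \<in> Poly_Mapping.keys (monomial e * h) \<longleftrightarrow> m \<in> Poly_Mapping.keys h"
  by (simp add: in_keys_iff lookup_monomial_mult)

lemma keys_mvar_mult:
  assumes "m \<in> Poly_Mapping.keys (mvar p * h)"
  obtains m' where "m' \<in> Poly_Mapping.keys h" "Poly_Mapping.keys m = insert p (Poly_Mapping.keys m')"
proof -
  obtain m' where "m' \<in> Poly_Mapping.keys h" "m = Poly_Mapping.single p (Suc 0) + m'"
    using assms keys_mult[of "mvar p" h] by (auto simp: monomial_def)
  then show ?thesis using that by (simp add: keys_add_nat)
qed

text \<open>The exponent of the variable may exceed one, so \<open>p\<close> can survive in the
  support of a monomial of the quotient; supports are therefore compared only after inserting
  \<open>p\<close>.\<close>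

lemma divide_mvar:
  fixes f :: "'k::field mpoly"
  assumes f: "f \<in> pcar n" and p: "\<And>m. m \<in> Poly_Mapping.keys f \<Longrightarrow> p \<in> Poly_Mapping.keys m"
  obtains h where "h \<in> pcar n" "f = mvar p * h"
    "\<forall>m\<in>Poly_Mapping.keys h. \<exists>m'\<in>Poly_Mapping.keys f. Poly_Mapping.keys m' = insert p (Poly_Mapping.keys m)"
proof -
  let ?e = "Poly_Mapping.single p (Suc 0)"
  define h where "h = (\<Sum>m\<in>Poly_Mapping.keys f. Poly_Mapping.single (m - ?e) (Poly_Mapping.lookup f m))"
  have "?e + (m - ?e) = m" if "m \<in> Poly_Mapping.keys f" for m
    using p[OF that] by (intro poly_mapping_eqI) (auto simp: lookup_add lookup_minus lookup_single when_def in_keys_iff)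
  then have "mvar p * h = (\<Sum>m\<in>Poly_Mapping.keys f. Poly_Mapping.single m (Poly_Mapping.lookup f m))"
    unfolding h_def monomial_def sum_distrib_left by (intro sum.cong) (auto simp: mult_single)
  then have eq: "f = mvar p * h" by (simp flip: pm_eq_sum_single)
  show ?thesis
  proof
    have "Poly_Mapping.keys (m - ?e) \<subseteq> {1..n}" if "m \<in> Poly_Mapping.keys f" for m
    proof -
      have "Poly_Mapping.keys (m - ?e) \<subseteq> Poly_Mapping.keys m"
        by (auto simp: in_keys_iff lookup_minus)
      then show ?thesis using f that by (auto simp: mem_pcar)
    qed
    then show "h \<in> pcar n"
      unfolding h_def by (intro pcar_sum) simp
    show "f = mvar p * h" by (rule eq)
    show "\<forall>m\<in>Poly_Mapping.keys h. \<exists>m'\<in>Poly_Mapping.keys f. Poly_Mapping.keys m' = insert p (Poly_Mapping.keys m)"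
    proof
      fix m assume "m \<in> Poly_Mapping.keys h"
      then have "?e + m \<in> Poly_Mapping.keys f"
        unfolding eq by (simp only: in_keys_monomial_mult)
      then show "\<exists>m'\<in>Poly_Mapping.keys f. Poly_Mapping.keys m' = insert p (Poly_Mapping.keys m)"
        by (intro bexI[of _ "?e + m"]) (simp_all add: keys_add_nat)
    qed
  qed
qed

text \<open>
  A squarefree monomial ideal is determined by the supports of its monomials. The sets in \<open>L\<close> may
  contain any variable indices, so the same \<open>L\<close> describes the ideal and all its extensions to
  \<open>A\<^bsub>[m]\<^esub>\<close>.
\<close>

definition support_ideal :: "nat \<Rightarrow> nat set set \<Rightarrow> 'k::field mpoly set" where
  "support_ideal n L = {f \<in> pcar n. \<forall>m\<in>Poly_Mapping.keys f. Poly_Mapping.keys m \<in> L}"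

definition up_closed :: "nat set set \<Rightarrow> bool" where
  "up_closed L \<longleftrightarrow> (\<forall>U\<in>L. finite U \<and> (\<forall>W. finite W \<longrightarrow> U \<subseteq> W \<longrightarrow> W \<in> L))"

lemma up_closedD: "up_closed L \<Longrightarrow> U \<in> L \<Longrightarrow> finite W \<Longrightarrow> U \<subseteq> W \<Longrightarrow> W \<in> L"
  unfolding up_closed_def by blast

lemma up_closed_finite: "up_closed L \<Longrightarrow> U \<in> L \<Longrightarrow> finite U"
  unfolding up_closed_def by blast

lemma support_ideal_subset: "support_ideal n L \<subseteq> pcar n"
  by (auto simp: support_ideal_def)

lemma support_ideal_add:
  "f \<in> support_ideal n L \<Longrightarrow> g \<in> support_ideal n L \<Longrightarrow> f + g \<in> support_ideal n L"
  using keys_add[of f g] by (auto simp: support_ideal_def intro: pcar_add)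

lemma support_ideal_mult:
  assumes "up_closed L" "f \<in> support_ideal n L" "g \<in> pcar n"
  shows "g * f \<in> support_ideal n L"
proof -
  have "Poly_Mapping.keys m \<in> L" if m: "m \<in> Poly_Mapping.keys (g * f)" for m
  proof -
    obtain a b where "m = a + b" "b \<in> Poly_Mapping.keys f"
      using keys_mult[of g f] m by blast
    then have "Poly_Mapping.keys b \<in> L" "Poly_Mapping.keys b \<subseteq> Poly_Mapping.keys m"
      using assms(2) by (simp_all add: support_ideal_def keys_add_nat)
    then show ?thesis using up_closedD[OF assms(1)] finite_keys by blast
  qed
  then show ?thesis using assms by (auto simp: support_ideal_def)
qed

lemma ideal_support_ideal:
  assumes "up_closed L"
  shows "ideal (support_ideal n L :: 'k::field mpoly set) (pring n)"
proof (rule idealI[OF ring_pring])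
  have grp: "Group.group (add_monoid (pring n :: 'k mpoly ring))"
    by (rule abelian_group.a_group[OF ring.is_abelian_group[OF ring_pring]])
  show "subgroup (support_ideal n L :: 'k mpoly set) (add_monoid (pring n))"
  proof (rule group.subgroupI[OF grp])
    show "(support_ideal n L :: 'k mpoly set) \<noteq> {}" by (auto simp: support_ideal_def intro!: exI[of _ 0])
    fix a :: "'k mpoly" assume a: "a \<in> support_ideal n L"
    then have "inv\<^bsub>add_monoid (pring n)\<^esub> a = - a"
      by (intro group.inv_equality[OF grp]) (auto simp: support_ideal_def)
    then show "inv\<^bsub>add_monoid (pring n)\<^esub> a \<in> support_ideal n L"
      using a by (simp add: support_ideal_def)
  next
    fix a b :: "'k mpoly" assume "a \<in> support_ideal n L" "b \<in> support_ideal n L"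
    then show "a \<otimes>\<^bsub>add_monoid (pring n)\<^esub> b \<in> support_ideal n L"
      by (simp add: support_ideal_add)
  qed (auto simp: support_ideal_def)
next
  fix a x :: "'k mpoly" assume "a \<in> support_ideal n L" "x \<in> pcar n"
  then have "x * a \<in> support_ideal n L" by (rule support_ideal_mult[OF assms])
  then show "x \<otimes>\<^bsub>pring n\<^esub> a \<in> support_ideal n L" "a \<otimes>\<^bsub>pring n\<^esub> x \<in> support_ideal n L"
    by (simp_all add: mult.commute)
qed

lemma ideal_sum:
  assumes "ideal I (pring n)" "\<And>b. b \<in> B \<Longrightarrow> f b \<in> I"
  shows "(\<Sum>b\<in>B. f b) \<in> I"
proof -
  have I: "additive_subgroup I (pring n)" by (rule ideal.axioms(1)[OF assms(1)])
  show ?thesis using assms(2)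
    using additive_subgroup.zero_closed[OF I] additive_subgroup.a_closed[OF I]
    by (induction B rule: infinite_finite_induct) auto
qed

definition multiples_supports :: "mon set \<Rightarrow> nat set set" where
  "multiples_supports G = {U. finite U \<and> (\<exists>g\<in>G. Poly_Mapping.keys g \<subseteq> U)}"

lemma up_closed_multiples_supports: "up_closed (multiples_supports G)"
  by (auto simp: up_closed_def multiples_supports_def)

text \<open>\<open>g\<close> is squarefree, so inclusion of supports is already divisibility,
  whatever the exponents of \<open>m\<close>.\<close>

lemma single_in_ideal:
  assumes I: "ideal I (pring n)" and g: "monomial g \<in> I" "sqfree n g"
    and m: "Poly_Mapping.keys g \<subseteq> Poly_Mapping.keys m" "Poly_Mapping.keys m \<subseteq> {1..n}"
  shows "Poly_Mapping.single m c \<in> I"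
proof -
  interpret ideal I "pring n" by (rule I)
  have "(m - g) + g = m"
  proof (rule poly_mapping_eqI)
    fix i
    have "Poly_Mapping.lookup g i \<le> Poly_Mapping.lookup m i"
    proof (cases "i \<in> Poly_Mapping.keys g")
      case True
      then have "i \<in> Poly_Mapping.keys m" using m(1) by blast
      then have "0 < Poly_Mapping.lookup m i" by (simp add: in_keys_iff)
      moreover have "Poly_Mapping.lookup g i \<le> 1" using g(2) by (simp add: sqfree_def)
      ultimately show ?thesis by linarith
    qed (simp add: in_keys_iff)
    then show "Poly_Mapping.lookup (m - g + g) i = Poly_Mapping.lookup m i"
      by (simp add: lookup_add lookup_minus)
  qed
  then have "Poly_Mapping.single m c = Poly_Mapping.single (m - g) c * monomial g"
    by (simp add: monomial_def mult_single)
  moreover have "Poly_Mapping.single (m - g) c \<in> pcar n"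
    using m(2) by (auto simp: in_keys_iff lookup_minus)
  ultimately show ?thesis using I_l_closed[OF g(1)] by simp
qed

lemma genideal_monomials:
  assumes "\<forall>g\<in>G. sqfree n g"
  shows "genideal (pring n) (monomial ` G) = (support_ideal n (multiples_supports G) :: 'k::field mpoly set)"
proof
  have "monomial ` G \<subseteq> (support_ideal n (multiples_supports G) :: 'k mpoly set)"
    using assms by (auto simp: support_ideal_def multiples_supports_def monomial_def sqfree_def)
  then show "genideal (pring n) (monomial ` G) \<subseteq> (support_ideal n (multiples_supports G) :: 'k mpoly set)"
    using ideal_support_ideal[OF up_closed_multiples_supports] unfolding genideal_def by blast
  show "(support_ideal n (multiples_supports G) :: 'k mpoly set) \<subseteq> genideal (pring n) (monomial ` G)"
    unfolding genideal_def
  proof (intro subsetI InterI)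
    fix f :: "'k mpoly" and I :: "'k mpoly set"
    assume f: "f \<in> support_ideal n (multiples_supports G)" and "I \<in> {I. ideal I (pring n) \<and> monomial ` G \<subseteq> I}"
    then have I: "ideal I (pring n)" "monomial ` G \<subseteq> I" by auto
    have "Poly_Mapping.single m (Poly_Mapping.lookup f m) \<in> I" if m: "m \<in> Poly_Mapping.keys f" for m
    proof -
      obtain g where "g \<in> G" "Poly_Mapping.keys g \<subseteq> Poly_Mapping.keys m"
        using f m by (auto simp: support_ideal_def multiples_supports_def)
      then show ?thesis
        using f m I assms by (intro single_in_ideal[OF I(1), of g]) (auto simp: support_ideal_def mem_pcar)
    qed
    then have "(\<Sum>m\<in>Poly_Mapping.keys f. Poly_Mapping.single m (Poly_Mapping.lookup f m)) \<in> I"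
      by (rule ideal_sum[OF I(1)])
    then show "f \<in> I" by (simp flip: pm_eq_sum_single)
  qed
qed

section \<open>Lexicographic order on supports and the induction over the variables\<close>

definition lex_above :: "nat set \<Rightarrow> nat set \<Rightarrow> bool" where
  "lex_above W U \<longleftrightarrow> (\<exists>a\<in>W - U. \<forall>b<a. b \<in> W \<longleftrightarrow> b \<in> U)"

text \<open>With no upper bound on indices, \<open>W\<close> may use new variables, which covers all
  extensions at once; the lower bound \<open>p\<close> confines the comparison to variables not yet
  peeled off.\<close>

definition universal_lex :: "nat \<Rightarrow> nat set set \<Rightarrow> bool" where
  "universal_lex p L \<longleftrightarrow> (\<forall>U W. U \<in> L \<longrightarrow> finite W \<longrightarrow> U \<subseteq> {p..} \<longrightarrow> W \<subseteq> {p..} \<longrightarrow>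
     card U = card W \<longrightarrow> lex_above W U \<longrightarrow> W \<in> L)"

lemma universal_lexD:
  "universal_lex p L \<Longrightarrow> U \<in> L \<Longrightarrow> finite W \<Longrightarrow> U \<subseteq> {p..} \<Longrightarrow> W \<subseteq> {p..} \<Longrightarrow>
    card U = card W \<Longrightarrow> lex_above W U \<Longrightarrow> W \<in> L"
  unfolding universal_lex_def by metis

lemma has_corner_support_ideal:
  assumes "up_closed L" "universal_lex p L" "{} \<notin> L" "1 \<le> p" "p \<le> Suc n"
    and "\<And>U. finite U \<Longrightarrow> U \<in> L \<longleftrightarrow> U \<inter> {p..n} \<in> L"
  shows "\<exists>k l. has_corner n (support_ideal n L :: 'k::field mpoly set) k l \<and> (L \<noteq> {} \<longrightarrow> k > 0)"
  using assms
proof (induction "Suc n - p" arbitrary: p L)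
  case 0
  \<comment> \<open>Here \<open>p = Suc n\<close>, the window \<open>{p..n}\<close> is empty, and
    any member of \<open>L\<close> would force \<open>{}\<close> into \<open>L\<close>.\<close>
  have "L = {}"
  proof (rule ccontr)
    assume "L \<noteq> {}"
    then obtain U where "U \<in> L" "finite U" using "0.prems"(1) unfolding up_closed_def by blast
    moreover have "U \<inter> {p..n} = {}" using "0.hyps" by auto
    ultimately show False using "0.prems"(3,6) by metis
  qed
  then have "support_ideal n L = ({0} :: 'k mpoly set)"
    by (auto simp: support_ideal_def)
  then show ?case using has_corner_zero \<open>L = {}\<close> by auto
next
  case (Suc d)
  note up = Suc.prems(1) and lex = Suc.prems(2) and gen = Suc.prems(6)
  have p: "1 \<le> p" "p \<le> n" using Suc.hyps(2) Suc.prems(4) by auto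
  let ?x = "mvar p :: 'k mpoly"
  have "Poly_Mapping.keys ?x \<noteq> Poly_Mapping.keys (0 :: 'k mpoly)" by (simp add: monomial_def)
  then have "?x \<noteq> 0" by metis
  moreover have "?x \<in> pcar n" "homogeneous ?x 1"
    using p by (auto simp: monomial_def homogeneous_def mdeg_def)
  ultimately have x: "?x \<in> pcar n" "homogeneous ?x 1" "?x \<noteq> 0" by blast+
  show ?case
  proof (cases "{p} \<in> L")
    case True
    \<comment> \<open>The ideal generated by the monomials of the given one that avoid
      \<open>X_p\<close>. Membership in \<open>L'\<close> ignores \<open>p\<close>, which makes
      \<open>X_p\<close> regular modulo this ideal.\<close>
    define L' where "L' = {U. U - {p} \<in> L}"
    have up': "up_closed L'"
      unfolding up_closed_def
    proof (intro ballI conjI allI impI)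
      fix U assume "U \<in> L'"
      then have U: "U - {p} \<in> L" by (simp add: L'_def)
      then have "finite (U - {p})" by (rule up_closed_finite[OF up])
      then show "finite U" by simp
      fix W assume "finite W" "U \<subseteq> W"
      then have "W - {p} \<in> L" by (intro up_closedD[OF up U]) auto
      then show "W \<in> L'" by (simp add: L'_def)
    qed
    have "\<exists>k l. has_corner n (support_ideal n L' :: 'k mpoly set) k l \<and> (L' \<noteq> {} \<longrightarrow> k > 0)"
    proof (rule Suc.hyps(1)[of "Suc p"])
      show "universal_lex (Suc p) L'"
        unfolding universal_lex_def
      proof (intro allI impI)
        fix U W assume a: "U \<in> L'" "finite W" "U \<subseteq> {Suc p..}" "W \<subseteq> {Suc p..}" "card U = card W" "lex_above W U"
        then have eq: "U - {p} = U" "W - {p} = W" and sub: "U \<subseteq> {p..}" "W \<subseteq> {p..}" by auto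
        have "U \<in> L" using a(1) eq(1) by (simp add: L'_def)
        then have "W \<in> L" by (rule universal_lexD[OF lex _ a(2) sub a(5,6)])
        then show "W \<in> L'" using eq(2) by (simp add: L'_def)
      qed
      show "U \<in> L' \<longleftrightarrow> U \<inter> {Suc p..n} \<in> L'" if "finite U" for U
      proof -
        have "(U - {p}) \<inter> {p..n} = U \<inter> {Suc p..n} - {p}" by auto
        moreover have "(U \<inter> {Suc p..n} - {p}) \<inter> {p..n} = U \<inter> {Suc p..n} - {p}" by auto
        ultimately show ?thesis using gen[of "U - {p}"] that by (simp add: L'_def)
      qed
    qed (use Suc.hyps(2) Suc.prems(3) p up' in \<open>auto simp: L'_def\<close>)
    then obtain k l where kl: "has_corner n (support_ideal n L' :: 'k mpoly set) k l" by blast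
    have "has_corner n {f + ?x * h |f h. f \<in> support_ideal n L' \<and> h \<in> pcar n} (Suc k) l"
    proof (rule has_corner_cone[OF kl support_ideal_subset x(1,2)])
      fix f :: "'k mpoly" assume f: "f \<in> pcar n" "?x * f \<in> support_ideal n L'"
      have "Poly_Mapping.keys m \<in> L'" if "m \<in> Poly_Mapping.keys f" for m
      proof -
        have "Poly_Mapping.keys (Poly_Mapping.single p (Suc 0) + m) \<in> L'"
          using f(2) that unfolding support_ideal_def by (auto simp only: in_keys_monomial_mult mem_Collect_eq)
        then show ?thesis by (simp add: keys_add_nat L'_def insert_Diff_if)
      qed
      then show "f \<in> support_ideal n L'" using f(1) by (simp add: support_ideal_def)
    qed
    also have "{f + ?x * h |f h. f \<in> support_ideal n L' \<and> h \<in> pcar n} = support_ideal n L"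
    proof (intro equalityI subsetI)
      fix f assume "f \<in> {f + ?x * h |f h. f \<in> support_ideal n L' \<and> h \<in> pcar n}"
      then obtain g h where f: "f = g + ?x * h" "g \<in> support_ideal n L'" "h \<in> pcar n" by auto
      have "L' \<subseteq> L"
      proof
        fix U assume U: "U \<in> L'"
        then show "U \<in> L"
          using up_closedD[OF up, of "U - {p}" U] up_closed_finite[OF up'] by (auto simp: L'_def)
      qed
      then have "g \<in> support_ideal n L" using f(2) by (auto simp: support_ideal_def)
      moreover have "?x \<in> support_ideal n L"
        using x(1) True by (auto simp: support_ideal_def monomial_def)
      then have "?x * h \<in> support_ideal n L"
        using support_ideal_mult[OF up _ f(3)] by (metis mult.commute)
      ultimately show "f \<in> support_ideal n L" unfolding f(1) by (rule support_ideal_add)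
    next
      fix f :: "'k mpoly" assume f: "f \<in> support_ideal n L"
      \<comment> \<open>Terms free of \<open>X_p\<close> lie in the smaller ideal, all others are
        divisible by \<open>X_p\<close>.\<close>
      let ?g = "pm_filter (\<lambda>m. p \<notin> Poly_Mapping.keys m) f"
      let ?q = "pm_filter (\<lambda>m. \<not> p \<notin> Poly_Mapping.keys m) f"
      have "?g \<in> support_ideal n L'" using f by (auto simp: support_ideal_def L'_def)
      moreover have "?q \<in> pcar n" using f by (auto simp: support_ideal_def)
      then obtain h where "h \<in> pcar n" "?q = ?x * h"
        by (rule divide_mvar[of ?q n p]) auto
      ultimately show "f \<in> {f + ?x * h |f h. f \<in> support_ideal n L' \<and> h \<in> pcar n}"
        using pm_filter_split[of f "\<lambda>m. p \<notin> Poly_Mapping.keys m"] by auto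
    qed
    finally show ?thesis by blast
  next
    case False
    show ?thesis
    proof (cases "L = {}")
      case True
      then have "support_ideal n L = ({0} :: 'k mpoly set)"
        by (auto simp: support_ideal_def)
      then show ?thesis using has_corner_zero True by auto
    next
      case nonempty: False
      text \<open>
        A set in \<open>L\<close> avoiding \<open>p\<close> would lie below \<open>p\<close> together with large indices, whose part
        up to \<open>n\<close> is just \<open>{p}\<close>.
      \<close>
      have pU: "p \<in> U" if U: "U \<in> L" for U
      proof (rule ccontr)
        assume "p \<notin> U"
        \<comment> \<open>\<open>?V\<close> drops the indices below \<open>p\<close>, as
          \<open>universal_lex p\<close> requires. The interval beyond \<open>n\<close> has
          \<open>card ?V - 1\<close> elements, so \<open>?W\<close> and \<open>?V\<close> have equal
          size.\<close>
        let ?V = "U \<inter> {p..n}" and ?W = "insert p {Suc n..<n + card (U \<inter> {p..n})}"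
        have V: "?V \<in> L" using gen[of U] U up_closed_finite[OF up U] by simp
        then have "?V \<noteq> {}" using Suc.prems(3) by metis
        then have "card ?V > 0" by (simp add: card_gt_0_iff)
        then have "card ?V = card ?W" using p by simp
        moreover have "lex_above ?W ?V"
          using \<open>p \<notin> U\<close> p unfolding lex_above_def by (intro bexI[of _ p]) auto
        moreover have "?V \<subseteq> {p..}" "?W \<subseteq> {p..}" "finite ?W" using p by auto
        ultimately have "?W \<in> L" by (intro universal_lexD[OF lex V])
        then have "?W \<inter> {p..n} \<in> L" using gen[of ?W] by simp
        moreover have "?W \<inter> {p..n} = {p}" using p by auto
        ultimately show False using False by simp
      qed
      \<comment> \<open>The colon ideal by \<open>X_p\<close>; since every member of
        \<open>L\<close> contains \<open>p\<close>, the given ideal is \<open>X_p\<close> times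
        it.\<close>
      define L' where "L' = {U. insert p U \<in> L}"
      have up': "up_closed L'"
        unfolding up_closed_def
    proof (intro ballI conjI allI impI)
      fix U assume "U \<in> L'"
      then have U: "insert p U \<in> L" by (simp add: L'_def)
      then have "finite (insert p U)" by (rule up_closed_finite[OF up])
      then show "finite U" by simp
      fix W assume "finite W" "U \<subseteq> W"
      then have "insert p W \<in> L" by (intro up_closedD[OF up U]) auto
      then show "W \<in> L'" by (simp add: L'_def)
    qed
      \<comment> \<open>Nonemptiness turns the induction hypothesis into \<open>k > 0\<close>, the
        condition for multiplying.\<close>
      have L'_ne: "L' \<noteq> {}"
      proof -
        obtain U where "U \<in> L" using nonempty by blast
        then have "U \<in> L'" using pU by (simp add: L'_def insert_absorb)
        then show ?thesis by blast
      qed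
      have "\<exists>k l. has_corner n (support_ideal n L' :: 'k mpoly set) k l \<and> (L' \<noteq> {} \<longrightarrow> k > 0)"
      proof (rule Suc.hyps(1)[of "Suc p"])
        show "universal_lex (Suc p) L'"
          unfolding universal_lex_def
        proof (intro allI impI)
          fix U W assume a: "U \<in> L'" "finite W" "U \<subseteq> {Suc p..}" "W \<subseteq> {Suc p..}" "card U = card W" "lex_above W U"
          then have "p \<notin> U" "p \<notin> W" by auto
          have U: "insert p U \<in> L" and W: "finite (insert p W)" using a by (auto simp: L'_def)
          have sub: "insert p U \<subseteq> {p..}" "insert p W \<subseteq> {p..}" using a by auto
          have "finite U" using up_closed_finite[OF up' a(1)] .
          then have card: "card (insert p U) = card (insert p W)"
            using a \<open>p \<notin> U\<close> \<open>p \<notin> W\<close> by simp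
          \<comment> \<open>Adding the common element \<open>p\<close> to both sets keeps their
            first difference.\<close>
          have "lex_above (insert p W) (insert p U)"
            using a(6) \<open>p \<notin> W\<close> unfolding lex_above_def by auto
          then have "insert p W \<in> L" by (rule universal_lexD[OF lex U W sub card])
          then show "W \<in> L'" by (simp add: L'_def)
        qed
        show "U \<in> L' \<longleftrightarrow> U \<inter> {Suc p..n} \<in> L'" if "finite U" for U
        proof -
          have "insert p U \<inter> {p..n} = insert p (U \<inter> {Suc p..n}) \<inter> {p..n}" using p by auto
          then show ?thesis using gen[of "insert p U"] gen[of "insert p (U \<inter> {Suc p..n})"] that
            by (simp add: L'_def)
        qed
      \<comment> \<open>The requirement \<open>{} \<notin> L'\<close> is the case assumption
        \<open>{p} \<notin> L\<close>.\<close>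
      qed (use Suc.hyps(2) p up' False in \<open>auto simp: L'_def\<close>)
      then obtain k l where kl: "has_corner n (support_ideal n L' :: 'k mpoly set) k l" "k > 0"
        using L'_ne by blast
      have "has_corner n ((*) ?x ` support_ideal n L') k (Suc l)"
        by (rule has_corner_mult[OF kl(1) support_ideal_subset kl(2) x])
      also have "(*) ?x ` support_ideal n L' = support_ideal n L"
      proof (intro equalityI subsetI)
        fix f assume "f \<in> (*) ?x ` support_ideal n L'"
        then obtain h where h: "f = ?x * h" "h \<in> support_ideal n L'" by auto
        then have "Poly_Mapping.keys m \<in> L" if "m \<in> Poly_Mapping.keys f" for m
          using that unfolding h(1) by (rule_tac keys_mvar_mult) (auto simp: support_ideal_def L'_def)
        then show "f \<in> support_ideal n L"
          using x(1) h by (auto simp: support_ideal_def intro: pcar_mult)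
      next
        fix f :: "'k mpoly" assume f: "f \<in> support_ideal n L"
        then have "f \<in> pcar n" "\<And>m. m \<in> Poly_Mapping.keys f \<Longrightarrow> p \<in> Poly_Mapping.keys m"
          using pU by (auto simp: support_ideal_def)
        then obtain h where h: "h \<in> pcar n" "f = ?x * h"
          "\<forall>m\<in>Poly_Mapping.keys h. \<exists>m'\<in>Poly_Mapping.keys f. Poly_Mapping.keys m' = insert p (Poly_Mapping.keys m)"
          by (rule divide_mvar)
        have "insert p (Poly_Mapping.keys m) \<in> L" if m: "m \<in> Poly_Mapping.keys h" for m
        proof -
          obtain m' where "m' \<in> Poly_Mapping.keys f" "Poly_Mapping.keys m' = insert p (Poly_Mapping.keys m)"
            using h(3) m by blast
          then show ?thesis using f unfolding support_ideal_def by force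
        qed
        then have "h \<in> support_ideal n L'" using h(1) by (simp add: support_ideal_def L'_def)
        then show "f \<in> (*) ?x ` support_ideal n L'" using h(2) by blast
      qed
      finally show ?thesis using kl(2) by blast
    qed
  qed
qed

section \<open>Universal squarefree lexsegment ideals\<close>

lemma sorted_list_of_set_eqI:
  "sorted xs \<Longrightarrow> distinct xs \<Longrightarrow> set xs = A \<Longrightarrow> sorted_list_of_set A = xs"
  by (intro sorted_distinct_set_unique) auto

definition squarefree_mon :: "nat set \<Rightarrow> mon" where
  "squarefree_mon U = (\<Sum>i\<in>U. Poly_Mapping.single i 1)"

lemma lookup_squarefree_mon:
  "finite U \<Longrightarrow> Poly_Mapping.lookup (squarefree_mon U) i = (if i \<in> U then 1 else 0)"
  by (simp add: squarefree_mon_def lookup_sum lookup_single when_def)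

lemma keys_squarefree_mon: "finite U \<Longrightarrow> Poly_Mapping.keys (squarefree_mon U) = U"
  by (auto simp: in_keys_iff lookup_squarefree_mon split: if_splits)

lemma mdeg_squarefree_mon: "finite U \<Longrightarrow> mdeg (squarefree_mon U) = card U"
  by (simp add: mdeg_def keys_squarefree_mon lookup_squarefree_mon)

text \<open>Below the first difference \<open>a\<close> both sets share the part \<open>C\<close>,
  so their index lists agree before position \<open>card C\<close>. There \<open>W\<close> has
  \<open>a\<close> and \<open>U\<close> a larger entry, which exists because \<open>U = C\<close>
  would have fewer elements than \<open>W\<close>.\<close>

lemma slex_greater_squarefree_mon:
  assumes fin: "finite U" "finite W" and card: "card U = card W" and above: "lex_above W U"
  shows "slex_greater (squarefree_mon W) (squarefree_mon U)"
proof -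
  obtain a where a: "a \<in> W" "a \<notin> U" "\<And>b. b < a \<Longrightarrow> b \<in> W \<longleftrightarrow> b \<in> U"
    using above by (auto simp: lex_above_def)
  define C where "C = {b \<in> W. b < a}"
  let ?V = "{b \<in> W. a < b}" and ?U = "{b \<in> U. a < b}"
  have C: "finite C" using fin by (simp add: C_def)
  have U: "C \<union> ?U = U" and W: "C \<union> insert a ?V = W"
    using a by (auto simp: C_def) (metis linorder_neqE_nat)+
  have lW: "sorted_list_of_set W = sorted_list_of_set C @ a # sorted_list_of_set ?V"
    using fin C W by (intro sorted_list_of_set_eqI) (simp_all, auto simp: C_def sorted_append)
  have lU: "sorted_list_of_set U = sorted_list_of_set C @ sorted_list_of_set ?U"
    using fin C by (intro sorted_list_of_set_eqI) (simp_all add: U, auto simp: C_def sorted_append)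
  have lt: "card C < card W"
    using fin a by (intro psubset_card_mono) (auto simp: C_def)
  have "?U \<noteq> {}"
  proof
    assume "?U = {}"
    then have "C = U" using U by (metis sup_bot.right_neutral)
    then show False using lt card by simp
  qed
  then have "card ?U > 0"
    using fin by (simp add: card_gt_0_iff)
  then have "sorted_list_of_set ?U ! 0 \<in> set (sorted_list_of_set ?U)"
    by (intro nth_mem) simp
  then have hd: "a < sorted_list_of_set ?U ! 0"
    using fin by simp
  have "\<forall>t<card C. mindices (squarefree_mon W) ! t = mindices (squarefree_mon U) ! t"
    by (simp add: mindices_def keys_squarefree_mon fin lW lU nth_append)
  moreover have "mindices (squarefree_mon W) ! card C < mindices (squarefree_mon U) ! card C"
    using hd by (simp add: mindices_def keys_squarefree_mon fin lW lU nth_append)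
  ultimately show ?thesis
    using lt card unfolding slex_greater_def by (auto simp: mdeg_squarefree_mon fin)
qed

text \<open>The extension has the same monomial generators, and \<open>multiples_supports G\<close>
  does not depend on the number of variables.\<close>

lemma genideal_extension:
  assumes G: "\<forall>g\<in>G. sqfree n g"
  shows "genideal (pring (n + m)) (genideal (pring n) (monomial ` G)) =
    (support_ideal (n + m) (multiples_supports G) :: 'k::field mpoly set)"
proof
  let ?L = "multiples_supports G"
  have "support_ideal n ?L \<subseteq> (support_ideal (n + m) ?L :: 'k mpoly set)"
    by (force simp: support_ideal_def mem_pcar)
  then show "genideal (pring (n + m)) (genideal (pring n) (monomial ` G)) \<subseteq> (support_ideal (n + m) ?L :: 'k mpoly set)"
    using ideal_support_ideal[OF up_closed_multiples_supports] unfolding genideal_monomials[OF G]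
    by (auto simp: genideal_def)
  have G': "\<forall>g\<in>G. sqfree (n + m) g" using G by (force simp: sqfree_def)
  have "monomial ` G \<subseteq> genideal (pring n) (monomial ` G :: 'k mpoly set)"
    by (auto simp: genideal_def)
  then have "genideal (pring (n + m)) (monomial ` G) \<subseteq>
      genideal (pring (n + m)) (genideal (pring n) (monomial ` G :: 'k mpoly set))"
    unfolding genideal_def[of "pring (n + m)"] by blast
  then show "(support_ideal (n + m) ?L :: 'k mpoly set) \<subseteq>
      genideal (pring (n + m)) (genideal (pring n) (monomial ` G))"
    unfolding genideal_monomials[OF G'] .
qed

lemma USLI_has_corner:
  fixes I :: "'k::field mpoly set"
  assumes "USLI n I" "I \<noteq> {0}" "I \<noteq> pcar n"
  obtains k l where "has_corner n I (Suc k) l" "I \<subseteq> pcar n"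
proof -
  obtain G where G: "\<forall>g\<in>G. sqfree n g" and I: "I = genideal (pring n) (monomial ` G)"
    using assms(1) by (auto simp: USLI_def sqfree_lexsegment_ideal_def)
  define L where "L = multiples_supports G"
  have I_eq: "I = support_ideal n L"
    unfolding I L_def by (rule genideal_monomials[OF G])
  have up: "up_closed L" unfolding L_def by (rule up_closed_multiples_supports)
  have empty: "{} \<notin> L"
  proof
    assume "{} \<in> L"
    then have "support_ideal n L = (pcar n :: 'k mpoly set)"
      using up_closedD[OF up] by (auto simp: support_ideal_def)
    then show False using assms(3) I_eq by simp
  qed
  have nonempty: "L \<noteq> {}"
  proof
    assume "L = {}"
    then have "support_ideal n L = ({0} :: 'k mpoly set)" by (auto simp: support_ideal_def)
    then show False using assms(2) I_eq by simp
  qed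
  have gen: "U \<in> L \<longleftrightarrow> U \<inter> {1..n} \<in> L" if "finite U" for U
    using that G by (auto simp: L_def multiples_supports_def sqfree_def)
  have lex: "universal_lex 1 L"
    unfolding universal_lex_def
  proof (intro allI impI)
    fix U W assume U: "U \<in> L" and W: "finite W" and sub: "U \<subseteq> {1..}" "W \<subseteq> {1..}"
      and card: "card U = card W" and above: "lex_above W U"
    have fin: "finite U" by (rule up_closed_finite[OF up U])
    obtain N where N: "\<And>i. i \<in> U \<union> W \<Longrightarrow> i < N"
      using finite_nat_set_iff_bounded[of "U \<union> W"] fin W by blast
    \<comment> \<open>Enough new variables to accommodate both sets; \<open>Suc\<close> guarantees
      at least one, as \<open>USLI\<close> speaks of \<open>m \<ge> 1\<close>.\<close>
    let ?n = "n + Suc N" and ?u = "squarefree_mon U" and ?w = "squarefree_mon W"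
    have "sqfree_lexsegment_ideal ?n (genideal (pring ?n) I)"
      using assms(1) unfolding USLI_def by (metis le_add1 plus_1_eq_Suc)
    then have lex: "sqfree ?n u \<Longrightarrow> monomial u \<in> (support_ideal ?n L :: 'k mpoly set) \<Longrightarrow> sqfree ?n v \<Longrightarrow>
        mdeg u = mdeg v \<Longrightarrow> slex_greater v u \<Longrightarrow> monomial v \<in> (support_ideal ?n L :: 'k mpoly set)" for u v
      unfolding I genideal_extension[OF G] L_def sqfree_lexsegment_ideal_def by blast
    have le: "U \<subseteq> {1..?n}" "W \<subseteq> {1..?n}" using sub N by (fastforce dest: less_imp_le)+
    then have sq: "sqfree ?n ?u" "sqfree ?n ?w"
      by (auto simp: sqfree_def keys_squarefree_mon fin W lookup_squarefree_mon)
    have "monomial ?u \<in> (support_ideal ?n L :: 'k mpoly set)"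
      using U le by (simp add: support_ideal_def monomial_def keys_squarefree_mon fin)
    then have "monomial ?w \<in> (support_ideal ?n L :: 'k mpoly set)"
      by (rule lex[OF sq(1) _ sq(2)])
        (simp_all add: mdeg_squarefree_mon fin W card slex_greater_squarefree_mon above)
    then show "W \<in> L" by (simp add: support_ideal_def monomial_def keys_squarefree_mon W)
  qed
  have "\<exists>k l. has_corner n I k l \<and> (L \<noteq> {} \<longrightarrow> k > 0)"
    unfolding I_eq by (rule has_corner_support_ideal[OF up lex empty _ _ gen]) simp_all
  then obtain k l where "has_corner n I k l" "k > 0"
    using nonempty by blast
  then show ?thesis
    using that[of "k - 1" l] support_ideal_subset[of n L] unfolding I_eq by simp
qed

theorem proposition2p5:
  fixes n :: nat and I :: "'k::field mpoly set"
  assumes "USLI n I"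
    and "I \<noteq> {0}"
    and "I \<noteq> carrier (pring n)"
  shows "(\<exists>!(k, l). extremal_betti n I k l) \<and>
         (\<forall>k l. extremal_betti n I k l \<longrightarrow> betti n I k (int k + l) = 1)"
proof -
  obtain k l where "has_corner n I (Suc k) l" and sub: "I \<subseteq> carrier (pring n)"
    using USLI_has_corner[OF assms] .
  then obtain X where X: "quot_resolution n I X" and m: "minimal_complex X"
    and c: "single_corner X (Suc k) l"
    unfolding has_corner_def by blast
  define F where "F = (SOME F. graded_free_resolution n I F)"
  have "graded_free_resolution n I F"
    \<comment> \<open>\<open>truncate X\<close> shows that a graded free resolution exists, so the
      chosen \<open>F\<close> is one, possibly not minimal.\<close>
    unfolding F_def by (rule someI, rule graded_free_resolution_truncate[OF X sub])
  then have E: "quot_resolution n I (extend F)"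
    using sub by (rule quot_resolution_extend)
  have betti: "betti n I = tor_dim F" by (simp add: betti_def F_def)
  \<comment> \<open>Passing from the quotient to the ideal lowers the position by one and raises the
    row by one: \<open>Suc k + l\<close> is read as \<open>k + Suc l\<close>.\<close>
  have corner: "betti n I k (int k + int (Suc l)) = 1"
    unfolding betti using c by (intro tor_dim_eq_1[OF E X m]) (auto simp: single_corner_def)
  \<comment> \<open>All nonzero Betti numbers lie in the rectangle with far corner
    \<open>(k, Suc l)\<close>, which yields both extremality and uniqueness.\<close>
  have vanish: "i \<le> k \<and> j \<le> int (Suc l)" if nz: "betti n I i (int i + j) \<noteq> 0" for i j
  proof -
    obtain b where b: "b < rk X (Suc i)" "shift X (Suc i) b = int i + j"
      using tor_dim_eq_0[OF E X m, of i "int i + j"] nz unfolding betti by metis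
    have "rk X (Suc i) \<noteq> 0" using b(1) by simp
    then have "Suc i \<le> Suc k" using c unfolding single_corner_def by (meson not_less)
    moreover have "shift X (Suc i) b \<le> int (Suc i + l)"
      using b(1) c unfolding single_corner_def by blast
    ultimately show ?thesis using b(2) by simp
  qed
  have ext: "extremal_betti n I k (int (Suc l))"
    unfolding extremal_betti_def
  proof (intro conjI allI impI)
    fix i j assume "k \<le> i" "int (Suc l) \<le> j" "(i, j) \<noteq> (k, int (Suc l))"
    then show "betti n I i (int i + j) = 0" using vanish[of i j] by force
  qed (use corner in simp)
  \<comment> \<open>Another extremal position would lie in this rectangle, and its extremality would
    force the value at the far corner to be 0.\<close>
  have uniq: "k' = k \<and> l' = int (Suc l)" if e: "extremal_betti n I k' l'" for k' l'
  proof (rule ccontr)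
    assume "\<not> ?thesis"
    moreover have "k' \<le> k" "l' \<le> int (Suc l)"
      using vanish[of k' l'] e by (auto simp: extremal_betti_def)
    ultimately have "betti n I k (int k + int (Suc l)) = 0"
      using e unfolding extremal_betti_def by blast
    then show False using corner by simp
  qed
  have "\<exists>!(k, l). extremal_betti n I k l"
  proof (rule ex1I[of _ "(k, int (Suc l))"])
    show "case (k, int (Suc l)) of (k, l) \<Rightarrow> extremal_betti n I k l"
      using ext by (simp only: prod.case)
    fix y assume "case y of (k, l) \<Rightarrow> extremal_betti n I k l"
    then have "extremal_betti n I (fst y) (snd y)" by (simp only: case_prod_beta)
    from uniq[OF this] show "y = (k, int (Suc l))" by (simp add: prod_eq_iff)
  qed
  moreover have "betti n I k' (int k' + l') = 1" if "extremal_betti n I k' l'" for k' l'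
    using uniq[OF that] corner by metis
  ultimately show ?thesis by blast
qed

end
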